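(* Let $\Omega$ be a countably infinite set, $S=\mathrm{Sym}(\Omega)$, and let $\mathcal P$ be the set of partitions $A$ of $\Omega$ into finite subsets such that there is no common finite bound on the cardinalities of the members of $A$. Then the subgroups $S_{(A)}$ with $A\in\mathcal P$ are mutually $\approx$-equivalent, and a closed subgroup $G\le S$ is $\approx$-equivalent to these subgroups if and only if there exists a finite subset $\Gamma\subseteq\Omega$ such that all orbits of $G_{(\Gamma)}$ are finite, but there is no finite $\Gamma\subseteq\Omega$ for which the cardinalities of the orbits of $G_{(\Gamma)}$ have a common finite bound. Moreover, for $A\in\mathcal P$ one has $S_{(A)}\prec S$.
   Context: $\mathrm{Sym}(\Omega)$ is the group of all permutations of $\Omega$ (acting on the right). $S$ carries the function topology (pointwise convergence, $\Omega$ discrete); "closed" means closed in $S$. For a partition $A$ of $\Omega$, $S_{(A)}=\{f\in S:\Sigma f=\Sigma\text{ for all }\Sigma\in A\}$. For $G\le S$ and $\Gamma\subseteq\Omega$, $G_{(\Gamma)}$ is the pointwise stabilizer of $\Gamma$ in $G$. For subgroups $G_1,G_2\le S$: $G_1\preccurlyeq G_2$ means there is a finite $U\subseteq S$ with $G_1\le\langle G_2\cup U\rangle$; $G_1\approx G_2$ means $G_1\preccurlyeq G_2$ and $G_2\preccurlyeq G_1$; $G_1\prec G_2$ means $G_1\preccurlyeq G_2$ and not $G_2\preccurlyeq G_1$. *)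

theory Defs
  imports Main "HOL-Library.Countable"
begin

text \<open>Omega is the universe of a type 'a; permutations are bijections 'a \<Rightarrow> 'a.\<close>

definition Sym :: "('a \<Rightarrow> 'a) set" where
  "Sym = {f. bij f}"

inductive_set gen_by :: "('a \<Rightarrow> 'a) set \<Rightarrow> ('a \<Rightarrow> 'a) set" for X where
  gen_id: "id \<in> gen_by X"
| gen_base: "f \<in> X \<Longrightarrow> f \<in> gen_by X"
| gen_comp: "f \<in> gen_by X \<Longrightarrow> g \<in> gen_by X \<Longrightarrow> f \<circ> g \<in> gen_by X"
| gen_inv: "f \<in> gen_by X \<Longrightarrow> inv f \<in> gen_by X"

definition is_subgroup :: "('a \<Rightarrow> 'a) set \<Rightarrow> bool" where
  "is_subgroup G \<longleftrightarrow> G \<subseteq> Sym \<and> id \<in> G \<and>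
     (\<forall>f\<in>G. \<forall>g\<in>G. f \<circ> g \<in> G) \<and> (\<forall>f\<in>G. inv f \<in> G)"

text \<open>Closed in Sym with respect to the topology of pointwise convergence (Omega discrete):
  every permutation all of whose basic neighbourhoods meet G lies in G.\<close>
definition closed_in_Sym :: "('a \<Rightarrow> 'a) set \<Rightarrow> bool" where
  "closed_in_Sym G \<longleftrightarrow> (\<forall>f\<in>Sym. (\<forall>F. finite F \<longrightarrow> (\<exists>g\<in>G. \<forall>x\<in>F. g x = f x)) \<longrightarrow> f \<in> G)"

definition preceq :: "('a \<Rightarrow> 'a) set \<Rightarrow> ('a \<Rightarrow> 'a) set \<Rightarrow> bool" where
  "preceq G1 G2 \<longleftrightarrow> (\<exists>U. finite U \<and> U \<subseteq> Sym \<and> G1 \<subseteq> gen_by (G2 \<union> U))"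

definition equiv_sg :: "('a \<Rightarrow> 'a) set \<Rightarrow> ('a \<Rightarrow> 'a) set \<Rightarrow> bool" where
  "equiv_sg G1 G2 \<longleftrightarrow> preceq G1 G2 \<and> preceq G2 G1"

definition prec :: "('a \<Rightarrow> 'a) set \<Rightarrow> ('a \<Rightarrow> 'a) set \<Rightarrow> bool" where
  "prec G1 G2 \<longleftrightarrow> preceq G1 G2 \<and> \<not> preceq G2 G1"

definition Sym_part :: "'a set set \<Rightarrow> ('a \<Rightarrow> 'a) set" where
  "Sym_part A = {f \<in> Sym. \<forall>B\<in>A. f ` B = B}"

definition pstab :: "('a \<Rightarrow> 'a) set \<Rightarrow> 'a set \<Rightarrow> ('a \<Rightarrow> 'a) set" where
  "pstab G \<Gamma> = {g \<in> G. \<forall>x\<in>\<Gamma>. g x = x}"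

definition orbit_of :: "('a \<Rightarrow> 'a) set \<Rightarrow> 'a \<Rightarrow> 'a set" where
  "orbit_of H x = {h x | h. h \<in> H}"

definition finite_block_partition :: "'a set set \<Rightarrow> bool" where
  "finite_block_partition A \<longleftrightarrow> \<Union>A = UNIV \<and> {} \<notin> A \<and>
     (\<forall>B\<in>A. \<forall>C\<in>A. B \<noteq> C \<longrightarrow> B \<inter> C = {}) \<and> (\<forall>B\<in>A. finite B)"

definition unbounded_partitions :: "'a set set set" where
  "unbounded_partitions = {A. finite_block_partition A \<and> \<not> (\<exists>n::nat. \<forall>B\<in>A. card B \<le> n)}"

end

theory Submission
  imports Defs "HOL-Library.Countable_Set" "HOL-Library.Disjoint_Sets" "HOL-Library.FuncSet"
    "HOL-Combinatorics.Permutations"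
begin

text \<open>
  If the orbits of \<open>pstab G \<Gamma>\<close> are finite, then \<open>\<Omega>\<close> is the union of a chain of finite sets in which
  each \<open>g \<in> G\<close> eventually moves points by at most one step; such a \<open>g\<close> is a product of a finitary
  permutation and of permutations preserving the even and the odd pairs of consecutive layers. So
  \<open>G\<close> is below \<open>Sym_part A\<close>. Conversely, \<open>Sym_part A\<close> together with finitely many permutations
  generates only permutations of bounded displacement in a locally finite graph, and when every
  \<open>pstab G \<Gamma>\<close> has an infinite orbit a diagonal construction in the closed group \<open>G\<close> escapes all these
  bounds. If the orbits of \<open>pstab G \<Gamma>\<close> are uniformly bounded, balls of fixed radius in the
  corresponding graph are uniformly bounded, which \<open>Sym_part A\<close> violates. Finally, if the orbits are finite but
  never uniformly bounded, one permutation \<open>u\<close> can encode, on disjoint translates \<open>g Z\<^sub>n\<close> of suitable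
  finite sets \<open>Z\<^sub>n\<close>, all permutations of all \<open>Z\<^sub>n\<close>, and \<open>g\<^sup>-\<^sup>1 u g\<close> realizes any prescribed sequence of them;
  a swindle removes the uncontrolled part outside the \<open>Z\<^sub>n\<close>.
\<close>


section \<open>Permutations preserving a partition\<close>

lemma is_subgroupD:
  assumes "is_subgroup G"
  shows "f \<in> G \<Longrightarrow> bij f" "id \<in> G" "f \<in> G \<Longrightarrow> g \<in> G \<Longrightarrow> f \<circ> g \<in> G" "f \<in> G \<Longrightarrow> inv f \<in> G"
  using assms unfolding is_subgroup_def Sym_def by auto

lemma is_subgroup_Sym: "is_subgroup Sym"
  unfolding is_subgroup_def Sym_def by (auto intro: bij_comp bij_imp_bij_inv)

lemma bij_image_inv_eq: "bij f \<Longrightarrow> f ` B = B \<Longrightarrow> inv f ` B = B"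
  by (metis bij_is_inj image_inv_f_f)

lemma is_subgroup_Sym_part: "is_subgroup (Sym_part A)"
proof -
  have "(f \<circ> g) ` B = B" if "f ` B = B" "g ` B = B" for f g and B :: "'a set"
    using that by (metis image_comp)
  then show ?thesis
    unfolding is_subgroup_def Sym_part_def Sym_def
    by (auto simp: bij_image_inv_eq bij_imp_bij_inv simp del: o_apply intro: bij_comp)
qed

lemma is_subgroup_pstab:
  assumes "is_subgroup G"
  shows "is_subgroup (pstab G \<Gamma>)"
  using assms unfolding is_subgroup_def pstab_def Sym_def
  by (auto simp: bij_is_inj inv_f_eq)

lemma pstab_pstab: "pstab (pstab G \<Gamma>) \<Delta> = pstab G (\<Gamma> \<union> \<Delta>)"
  unfolding pstab_def by auto

lemma closed_in_Sym_pstab: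
  assumes "closed_in_Sym G"
  shows "closed_in_Sym (pstab G \<Gamma>)"
  unfolding closed_in_Sym_def
proof (intro ballI impI)
  fix f assume f: "f \<in> Sym" and app: "\<forall>F. finite F \<longrightarrow> (\<exists>g\<in>pstab G \<Gamma>. \<forall>x\<in>F. g x = f x)"
  have "\<exists>g\<in>G. \<forall>x\<in>F. g x = f x" if "finite F" for F
    using app[rule_format, OF that] by (auto simp: pstab_def)
  then have "f \<in> G" using assms f unfolding closed_in_Sym_def by simp
  moreover have "f x = x" if "x \<in> \<Gamma>" for x
  proof -
    obtain g where "g \<in> pstab G \<Gamma>" "g x = f x" using app[rule_format, of "{x}"] by auto
    then show ?thesis using that by (auto simp: pstab_def)
  qed
  ultimately show "f \<in> pstab G \<Gamma>" by (simp add: pstab_def)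
qed

section \<open>The generated group and the preorder \<open>preceq\<close>\<close>

lemma gen_by_subset:
  assumes "X \<subseteq> gen_by Y"
  shows "gen_by X \<subseteq> gen_by Y"
proof
  fix f assume "f \<in> gen_by X"
  then show "f \<in> gen_by Y"
    by induction (use assms in \<open>blast intro: gen_by.intros\<close>)+
qed

lemma gen_by_mono: "X \<subseteq> Y \<Longrightarrow> gen_by X \<subseteq> gen_by Y"
  by (intro gen_by_subset) (auto intro: gen_by.gen_base)

lemma preceq_subset: "G1 \<subseteq> G2 \<Longrightarrow> preceq G1 G2"
  unfolding preceq_def by (intro exI[of _ "{}"]) (auto intro: gen_by.gen_base)

lemma preceq_trans [trans]:
  assumes "preceq G1 G2" "preceq G2 G3"
  shows "preceq G1 G3"
proof -
  obtain U V where U: "finite U" "U \<subseteq> Sym" "G1 \<subseteq> gen_by (G2 \<union> U)"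
    and V: "finite V" "V \<subseteq> Sym" "G2 \<subseteq> gen_by (G3 \<union> V)"
    using assms unfolding preceq_def by blast
  have "G2 \<union> U \<subseteq> gen_by (G3 \<union> (U \<union> V))"
    using V(3) gen_by_mono[of "G3 \<union> V" "G3 \<union> (U \<union> V)"] by (auto intro: gen_by.gen_base)
  from gen_by_subset[OF this] U(3) have "G1 \<subseteq> gen_by (G3 \<union> (U \<union> V))" by blast
  then show ?thesis
    unfolding preceq_def using U V by (intro exI[of _ "U \<union> V"]) auto
qed

section \<open>Gluing and extending permutations\<close>

lemma glue_permutations:
  fixes T :: "'i \<Rightarrow> 'a set" and \<rho> :: "'i \<Rightarrow> 'a \<Rightarrow> 'a"
  assumes dj: "disjoint_family_on T I" and \<rho>: "\<And>i. i \<in> I \<Longrightarrow> bij_betw (\<rho> i) (T i) (T i)"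
  obtains u where "bij u" "\<And>i x. i \<in> I \<Longrightarrow> x \<in> T i \<Longrightarrow> u x = \<rho> i x"
    "\<And>x. x \<notin> (\<Union>i\<in>I. T i) \<Longrightarrow> u x = x"
proof -
  define u where "u x = (if \<exists>i\<in>I. x \<in> T i then \<rho> (SOME i. i \<in> I \<and> x \<in> T i) x else x)" for x
  have u1: "u x = \<rho> i x" if "i \<in> I" "x \<in> T i" for i x
  proof -
    have "(SOME i. i \<in> I \<and> x \<in> T i) = i"
      using dj that unfolding disjoint_family_on_def by (intro some_equality) blast+
    then show ?thesis using that unfolding u_def by auto
  qed
  have u2: "u x = x" if "x \<notin> (\<Union>i\<in>I. T i)" for x
    using that unfolding u_def by auto
  have u3: "bij_betw u (T i) (T i)" if "i \<in> I" for i
    using \<rho>[OF that] u1[OF that] by (simp cong: bij_betw_cong)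
  have "bij_betw u (\<Union>i\<in>I. T i) (\<Union>i\<in>I. T i)"
    using dj u3 by (intro bij_betw_UNION_disjoint) (auto simp: disjoint_family_on_def)
  moreover have "bij_betw u (- (\<Union>i\<in>I. T i)) (- (\<Union>i\<in>I. T i))"
    using u2 by (intro bij_betwI[of _ _ _ id]) auto
  ultimately have "bij_betw u ((\<Union>i\<in>I. T i) \<union> - (\<Union>i\<in>I. T i)) ((\<Union>i\<in>I. T i) \<union> - (\<Union>i\<in>I. T i))"
    by (intro bij_betw_combine) auto
  then have "bij u" by (simp only: Compl_partition)
  then show ?thesis using u1 u2 that by blast
qed

text \<open>Both complements are countably infinite, so any bijection between them completes
  \<open>f\<close>. The conjugators between families of blocks come from here.\<close>

lemma extend_injection:
  fixes f :: "'a::countable \<Rightarrow> 'a"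
  assumes "inj_on f X" "infinite (- X)" "infinite (- f ` X)"
  obtains u where "bij u" "\<And>x. x \<in> X \<Longrightarrow> u x = f x"
proof -
  obtain e where e: "bij_betw e (- X) (- f ` X)"
    using to_nat_on_infinite[OF _ assms(2)] to_nat_on_infinite[OF _ assms(3)]
      bij_betw_trans bij_betw_inv_into by blast
  define u where "u x = (if x \<in> X then f x else e x)" for x
  have "bij_betw u X (f ` X)"
    using assms(1) by (auto simp: bij_betw_def inj_on_def u_def)
  moreover have "bij_betw u (- X) (- f ` X)"
    using e by (subst bij_betw_cong[of _ _ e]) (auto simp: u_def)
  ultimately have "bij_betw u (X \<union> - X) (f ` X \<union> - f ` X)"
    by (intro bij_betw_combine) auto
  then have "bij u" by (simp only: Compl_partition)
  then show ?thesis using that by (auto simp: u_def)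
qed

section \<open>Comparing the groups of different partitions\<close>

text \<open>Unlike the blocks of a partition, the sets \<open>C n\<close> may be empty and need not
  cover. For a disjoint family this is the full product of the symmetric groups on the
  \<open>C n\<close>, acting trivially outside their union.\<close>

definition Sym_fam :: "(nat \<Rightarrow> 'a set) \<Rightarrow> ('a \<Rightarrow> 'a) set" where
  "Sym_fam C = {f \<in> Sym. (\<forall>n. f ` C n = C n) \<and> (\<forall>x. x \<notin> (\<Union>n. C n) \<longrightarrow> f x = x)}"

text \<open>Each \<open>D i\<close> is embedded into a member of \<open>C\<close> large enough to
  leave a point over, different \<open>i\<close> using different members. The points left over make
  the complement of the image infinite, so the embedding extends to a permutation \<open>u\<close>,
  and conjugation by \<open>u\<close> transports the action on \<open>D i\<close> into that larger
  set.\<close>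

lemma conjugate_into_Sym_fam:
  fixes C D :: "nat \<Rightarrow> 'a::countable set"
  assumes C: "disjoint_family C" "\<And>n. finite (C n)" "\<And>n. card (C n) \<ge> n"
    and D: "disjoint_family D" "\<And>n. finite (D n)" "infinite (- (\<Union>n. D n))"
  obtains u where "bij u" "\<And>g. g \<in> Sym_fam D \<Longrightarrow> u \<circ> g \<circ> inv u \<in> Sym_fam C"
proof -
  \<comment> \<open>Partial sums are strictly increasing, which makes the targets
    \<open>C (k i)\<close> distinct, and the extra 1 gives \<open>card (D i) < k i\<close>, so the
    embedding is never onto.\<close>
  define k where "k i = (\<Sum>l\<le>i. card (D l) + 1)" for i
  have "strict_mono k" by (rule strict_mono_Suc_iff[THEN iffD2]) (auto simp: k_def)
  then have kinj: "k i = k j \<Longrightarrow> i = j" for i j by (simp add: strict_mono_eq)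
  have kge: "card (D i) < k i" for i
    unfolding k_def by (subst less_eq_Suc_le, rule order_trans[OF _ member_le_sum[of i]]) auto
  have Cdj: "m = n" if "x \<in> C m" "x \<in> C n" for x m n
    using C(1) that unfolding disjoint_family_on_def by blast
  have Ddj: "m = n" if "x \<in> D m" "x \<in> D n" for x m n
    using D(1) that unfolding disjoint_family_on_def by blast
  have "\<exists>\<phi>. inj_on \<phi> (D i) \<and> \<phi> ` D i \<subset> C (k i)" for i
  proof -
    have lt: "card (D i) < card (C (k i))" using kge[of i] C(3)[of "k i"] by simp
    obtain \<phi> where "\<phi> ` D i \<subseteq> C (k i)" "inj_on \<phi> (D i)"
      using card_le_inj[OF D(2)[of i] C(2)[of "k i"]] lt by auto
    moreover from this lt have "\<phi> ` D i \<noteq> C (k i)" by (metis card_image less_irrefl)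
    ultimately show ?thesis by blast
  qed
  then obtain \<phi> where \<phi>: "\<And>i. inj_on (\<phi> i) (D i)" "\<And>i. \<phi> i ` D i \<subset> C (k i)" by metis
  define X where "X = (\<Union>n. D n)"
  define f where "f x = \<phi> (SOME i. x \<in> D i) x" for x
  have f: "f x = \<phi> i x" if "x \<in> D i" for x i
  proof -
    have "(SOME i. x \<in> D i) = i" using that Ddj by blast
    then show ?thesis by (simp add: f_def)
  qed
  have fC: "f x \<in> C (k i)" if "x \<in> D i" for x i using f[OF that] \<phi>(2)[of i] that by auto
  have "inj_on f X"
  proof (rule inj_onI)
    fix x y assume "x \<in> X" "y \<in> X" and eq: "f x = f y"
    then obtain i j where ij: "x \<in> D i" "y \<in> D j" by (auto simp: X_def)
    then have "k i = k j" using fC[OF ij(1)] fC[OF ij(2)] eq Cdj by auto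
    then have "i = j" by (rule kinj)
    then show "x = y" using ij eq f \<phi>(1)[of j] by (auto dest: inj_onD)
  qed
  moreover have "infinite (- f ` X)"
  proof -
    \<comment> \<open>One missed point per index: together they form an infinite set outside the
      image of \<open>f\<close>.\<close>
    have "\<exists>q. q \<in> C (k i) \<and> q \<notin> \<phi> i ` D i" for i using \<phi>(2)[of i] by blast
    then obtain q where q: "\<And>i. q i \<in> C (k i)" "\<And>i. q i \<notin> \<phi> i ` D i" by metis
    have "inj q" using q(1) Cdj kinj by (metis injI)
    moreover have "q i \<notin> f ` X" for i
    proof
      assume "q i \<in> f ` X"
      then obtain x j where x: "x \<in> D j" "q i = f x" by (auto simp: X_def)
      then have "k i = k j" using q(1) fC[OF x(1)] Cdj by metis
      then have "i = j" by (rule kinj)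
      then show False using x q(2)[of i] f by auto
    qed
    ultimately show ?thesis by (metis (no_types, lifting) ComplI finite_subset image_subsetI range_inj_infinite)
  qed
  ultimately obtain u where u: "bij u" "\<And>x. x \<in> X \<Longrightarrow> u x = f x"
    using extend_injection[of f X] D(3) unfolding X_def by blast
  have "u \<circ> g \<circ> inv u \<in> Sym_fam C" if g: "g \<in> Sym_fam D" for g
  proof -
    define h where "h = u \<circ> g \<circ> inv u"
    have bg: "bij g" using g by (simp add: Sym_fam_def Sym_def)
    then have bh: "bij h" unfolding h_def using u(1) by (intro bij_comp bij_imp_bij_inv)
    have hu: "h (u x) = u (g x)" for x
      unfolding h_def using u(1) by (simp add: bij_is_inj)
    have h_out: "h y = y" if "y \<notin> u ` X" for y
    proof -
      obtain x where x: "y = u x" using u(1) by (metis bij_pointE)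
      then have "x \<notin> X" using that by auto
      then have "g x = x" using g by (simp add: Sym_fam_def X_def)
      then show ?thesis using hu x by simp
    qed
    have h_in: "u x \<in> C (k i)" "h (u x) \<in> C (k i)" if "x \<in> D i" for x i
    proof -
      have "g x \<in> D i" using g that by (auto simp: Sym_fam_def)
      moreover have "x \<in> X" "g x \<in> X" using that calculation by (auto simp: X_def)
      ultimately show "u x \<in> C (k i)" "h (u x) \<in> C (k i)" using hu[of x] u(2)[of x] u(2)[of "g x"] fC[of _ i] that by simp_all
    qed
    have "h ` C n = C n" for n
    proof (rule card_subset_eq)
      show "h ` C n \<subseteq> C n"
      proof
        fix z assume "z \<in> h ` C n"
        then obtain y where y: "y \<in> C n" "z = h y" by auto
        show "z \<in> C n"
        proof (cases "y \<in> u ` X")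
          case True
          then obtain x i where "x \<in> D i" "y = u x" by (auto simp: X_def)
          then show ?thesis using h_in[of x i] y Cdj[of y n "k i"] by simp
        qed (use h_out y in auto)
      qed
      show "card (h ` C n) = card (C n)"
        using bh by (intro card_image) (auto simp: bij_def inj_on_def)
    qed (use C in auto)
    moreover have "h y = y" if "y \<notin> (\<Union>n. C n)" for y
      by (rule h_out) (use that h_in(1) in \<open>auto simp: X_def\<close>)
    ultimately show ?thesis using bh unfolding Sym_fam_def Sym_def h_def by auto
  qed
  then show ?thesis using that u(1) by blast
qed

lemma finite_block_partitionD:
  assumes "finite_block_partition A"
  shows "\<exists>B\<in>A. x \<in> B" "B \<in> A \<Longrightarrow> finite B" "B \<in> A \<Longrightarrow> B \<noteq> {}"
    "B \<in> A \<Longrightarrow> C \<in> A \<Longrightarrow> B \<noteq> C \<Longrightarrow> B \<inter> C = {}"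
proof -
  have "x \<in> \<Union> A" using assms by (simp add: finite_block_partition_def)
  then show "\<exists>B\<in>A. x \<in> B" by simp
qed (use assms in \<open>auto simp: finite_block_partition_def\<close>)

lemma finite_block_partition_blocks:
  assumes "finite_block_partition (A :: 'a::countable set set)" "infinite (UNIV :: 'a set)"
  obtains a where "disjoint_family a" "range a = A" "\<And>n::nat. finite (a n)"  "\<And>n. a n \<noteq> {}"
proof -
  have "infinite A"
    using assms finite_Union[of A] unfolding finite_block_partition_def by metis
  moreover have "countable A"
    by (rule countable_subset[OF _ countable_Collect_finite]) (use assms in \<open>auto simp: finite_block_partition_def\<close>)
  ultimately have "bij_betw (from_nat_into A) UNIV A"
    by (simp add: bij_betw_from_nat_into)
  then have *: "range (from_nat_into A) = A" "inj (from_nat_into A)" by (auto simp: bij_betw_def)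
  show ?thesis
  proof (rule that[OF _ *(1)])
    show "disjoint_family (from_nat_into A)"
      unfolding disjoint_family_on_def
    proof (intro ballI impI)
      fix m n :: nat assume "m \<noteq> n"
      then have "from_nat_into A m \<noteq> from_nat_into A n" using *(2) by (simp add: inj_eq)
      then show "from_nat_into A m \<inter> from_nat_into A n = {}"
        using *(1) by (intro finite_block_partitionD(4)[OF assms(1)]) auto
    qed
    show "finite (from_nat_into A n)" "from_nat_into A n \<noteq> {}" for n
      using finite_block_partitionD(2,3)[OF assms(1), of "from_nat_into A n"] *(1) by auto
  qed
qed

text \<open>Conjugation into \<open>Sym_fam C\<close> needs a family whose union has infinite
  complement, and a partition covers everything. The blocks are therefore split into those of even
  and of odd index; each half lies in the complement of the other, and a permutation preserving all
  blocks is the product of its parts on the two halves. Two conjugators are enough.\<close>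

lemma Sym_part_preceq_Sym_fam:
  fixes C :: "nat \<Rightarrow> 'a::countable set"
  assumes inf: "infinite (UNIV :: 'a set)"
    and C: "disjoint_family C" "\<And>n. finite (C n)" "\<And>n. card (C n) \<ge> n"
    and A: "finite_block_partition A"
  shows "preceq (Sym_part A) (Sym_fam C)"
proof -
  obtain a where a: "disjoint_family a" "range a = A" "\<And>n::nat. finite (a n)" "\<And>n. a n \<noteq> {}"
    by (rule finite_block_partition_blocks[OF A inf]) blast
  have adj: "m = n" if "x \<in> a m" "x \<in> a n" for x m n
    using a(1) that unfolding disjoint_family_on_def by blast
  have cov: "\<exists>n. x \<in> a n" for x
    using finite_block_partitionD(1)[OF A] a(2) by fast
  define E where "E e i = a (2 * i + e)" for e i :: nat
  have E_dj: "disjoint_family (E e)" for e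
    using a(1) unfolding disjoint_family_on_def E_def by auto
  have E_parity: "x \<notin> E 1 j" if "x \<in> E 0 i" for x i j
  proof
    assume "x \<in> E 1 j"
    with that have "2 * i + 0 = 2 * j + 1" unfolding E_def by (rule adj)
    then show False by presburger
  qed
  have infu: "infinite (\<Union>i. E e i)" for e
  proof -
    define q where "q i = (SOME x. x \<in> E e i)" for i
    have q: "q i \<in> E e i" for i using a(4) by (simp add: q_def some_in_eq E_def)
    have "inj q"
    proof (rule injI)
      fix i j assume "q i = q j"
      then have "q i \<in> a (2 * i + e)" "q i \<in> a (2 * j + e)"
        using q[of i] q[of j] by (simp_all add: E_def)
      then have "2 * i + e = 2 * j + e" by (rule adj)
      then show "i = j" by simp
    qed
    moreover have "range q \<subseteq> (\<Union>i. E e i)" using q by blast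
    ultimately show ?thesis by (rule infinite_super[OF _ range_inj_infinite, rotated])
  qed
  have inf1: "infinite (- (\<Union>i. E 0 i))"
    by (rule infinite_super[OF _ infu[of 1]]) (use E_parity in blast)
  have inf2: "infinite (- (\<Union>i. E 1 i))"
    by (rule infinite_super[OF _ infu[of 0]]) (use E_parity in blast)
  have E_fin: "finite (E e i)" for e i by (simp add: E_def a(3))
  obtain u where u: "bij u" "\<And>g. g \<in> Sym_fam (E 0) \<Longrightarrow> u \<circ> g \<circ> inv u \<in> Sym_fam C"
    by (rule conjugate_into_Sym_fam[OF C E_dj E_fin inf1]) blast
  obtain v where v: "bij v" "\<And>g. g \<in> Sym_fam (E 1) \<Longrightarrow> v \<circ> g \<circ> inv v \<in> Sym_fam C"
    by (rule conjugate_into_Sym_fam[OF C E_dj E_fin inf2]) blast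
  let ?H = "gen_by (Sym_fam C \<union> {u, v})"
  have conj: "g \<in> ?H" if "bij w" "w \<in> {u, v}" "w \<circ> g \<circ> inv w \<in> Sym_fam C" for g w
  proof -
    have "inv w \<circ> ((w \<circ> g \<circ> inv w) \<circ> w) \<in> ?H"
      by (intro gen_by.gen_comp gen_by.gen_inv gen_by.gen_base) (use that in auto)
    moreover have "inv w \<circ> ((w \<circ> g \<circ> inv w) \<circ> w) = g"
      using that(1) by (auto simp: fun_eq_iff bij_is_inj)
    ultimately show ?thesis by simp
  qed
  have "g \<in> ?H" if "g \<in> Sym_part A" for g
  proof -
    have bg: "bij g" and gA: "g ` a n = a n" for n
      using that a(2) by (auto simp: Sym_part_def Sym_def)
    have gb: "bij_betw g (E e i) (E e i)" for e i
      using bg gA unfolding E_def by (metis bij_betw_def inj_on_subset subset_UNIV)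
    obtain g0 where g0: "bij g0" "\<And>i x. x \<in> E 0 i \<Longrightarrow> g0 x = g x"
      "\<And>x. x \<notin> (\<Union>i. E 0 i) \<Longrightarrow> g0 x = x"
      by (rule glue_permutations[OF E_dj[of 0], where \<rho>="\<lambda>_. g", OF gb]) blast
    obtain g1 where g1: "bij g1" "\<And>i x. x \<in> E 1 i \<Longrightarrow> g1 x = g x"
      "\<And>x. x \<notin> (\<Union>i. E 1 i) \<Longrightarrow> g1 x = x"
      by (rule glue_permutations[OF E_dj[of 1], where \<rho>="\<lambda>_. g", OF gb]) blast
    have gE: "g ` E e i = E e i" for e i by (simp add: E_def gA)
    have "g0 ` E 0 i = E 0 i" "g1 ` E 1 i = E 1 i" for i
      using g0(2)[of _ i] g1(2)[of _ i] gE[of _ i] by (simp_all cong: image_cong)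
    then have "g0 \<in> Sym_fam (E 0)" "g1 \<in> Sym_fam (E 1)"
      using g0(1,3) g1(1,3) unfolding Sym_fam_def Sym_def by blast+
    moreover have "g = g0 \<circ> g1"
    proof
      fix x
      obtain n where n: "x \<in> a n" using cov by blast
      have "n = 2 * (n div 2) + 0 \<or> n = 2 * (n div 2) + 1" by presburger
      then obtain i where "n = 2 * i + 0 \<or> n = 2 * i + 1" by blast
      then consider "x \<in> E 0 i" | "x \<in> E 1 i" using n unfolding E_def by blast
      then show "g x = (g0 \<circ> g1) x"
      proof cases
        case 1
        then show ?thesis using g0(2)[OF 1] g1(3)[of x] E_parity[OF 1] by simp
      next
        case 2
        then have "g x \<in> E 1 i" using gE[of 1 i] by auto
        then have "g x \<notin> (\<Union>i. E 0 i)" using E_parity by blast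
        then show ?thesis using g0(3)[of "g x"] g1(2)[OF 2] by simp
      qed
    qed
    ultimately show ?thesis
      using gen_by.gen_comp[OF conj[OF u(1) _ u(2)] conj[OF v(1) _ v(2)]] by blast
  qed
  then show ?thesis
    unfolding preceq_def using u(1) v(1) by (intro exI[of _ "{u, v}"]) (auto simp: Sym_def)
qed

text \<open>Unboundedness allows each next block to be larger than the one before. The strict growth
  makes the chosen blocks distinct, hence disjoint; all other blocks are fixed pointwise.\<close>

lemma Sym_fam_subset_Sym_part:
  assumes "A \<in> unbounded_partitions"
  obtains C where "disjoint_family C" "\<And>n. finite (C n)" "\<And>n. card (C n) \<ge> n" "Sym_fam C \<subseteq> Sym_part A"
proof -
  have A: "finite_block_partition A" and unb: "\<exists>B\<in>A. n < card B" for n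
    using assms unfolding unbounded_partitions_def by (auto simp: not_le)
  have "\<exists>C. \<forall>n::nat. (C n \<in> A \<and> n \<le> card (C n)) \<and> card (C n) < card (C (Suc n))"
  proof (rule dependent_nat_choice)
    show "\<exists>x. x \<in> A \<and> 0 \<le> card x" using unb[of 0] by auto
    show "\<exists>y. (y \<in> A \<and> Suc n \<le> card y) \<and> card x < card y" if "x \<in> A \<and> n \<le> card x" for x n
      using unb[of "card x"] that by force
  qed
  then obtain C where C: "\<And>n. C n \<in> A" "\<And>n. n \<le> card (C n)" "\<And>n. card (C n) < card (C (Suc n))"
    by blast
  have "strict_mono (\<lambda>n. card (C n))" using C(3) by (simp add: strict_mono_Suc_iff)
  then have Cinj: "C m = C n \<Longrightarrow> m = n" for m n by (metis strict_mono_eq)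
  have disj: "B \<inter> B' = {}" if "B \<in> A" "B' \<in> A" "B \<noteq> B'" for B B'
    using finite_block_partitionD(4)[OF A] that .
  show ?thesis
  proof (rule that)
    show "disjoint_family C"
      unfolding disjoint_family_on_def using Cinj disj C(1) by metis
    show "finite (C n)" for n using finite_block_partitionD(2)[OF A] C(1) .
    show "n \<le> card (C n)" for n by (rule C(2))
    show "Sym_fam C \<subseteq> Sym_part A"
    proof
      fix f assume f: "f \<in> Sym_fam C"
      have "f ` B = B" if B: "B \<in> A" for B
      proof (cases "B \<in> range C")
        case True
        then show ?thesis using f by (auto simp: Sym_fam_def)
      next
        case False
        then have "B \<inter> C n = {}" for n using disj[OF B C(1)] by auto
        then have "x \<notin> (\<Union>n. C n)" if "x \<in> B" for x using that by blast
        then have "f x = x" if "x \<in> B" for x using f that unfolding Sym_fam_def by blast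
        then show ?thesis by simp
      qed
      then show "f \<in> Sym_part A" using f by (simp add: Sym_fam_def Sym_part_def)
    qed
  qed
qed

lemma Sym_part_preceq_Sym_part:
  fixes A B :: "'a::countable set set"
  assumes "infinite (UNIV :: 'a set)" "finite_block_partition A" "B \<in> unbounded_partitions"
  shows "preceq (Sym_part A) (Sym_part B)"
proof -
  obtain C where C: "disjoint_family C" "\<And>n. finite (C n)" "\<And>n. card (C n) \<ge> n" "Sym_fam C \<subseteq> Sym_part B"
    by (rule Sym_fam_subset_Sym_part[OF assms(3)]) blast
  then show ?thesis
    using preceq_trans[OF Sym_part_preceq_Sym_fam[OF assms(1) C(1-3) assms(2)] preceq_subset[OF C(4)]] by blast
qed

section \<open>Displacement\<close>

lemma glue_Sym_fam:
  assumes "disjoint_family C" "\<And>n. bij_betw (\<rho> n) (C n) (C n)"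
  obtains u where "u \<in> Sym_fam C" "\<And>n x. x \<in> C n \<Longrightarrow> u x = \<rho> n x"
proof -
  obtain u where u: "bij u" "\<And>n x. x \<in> C n \<Longrightarrow> u x = \<rho> n x" "\<And>x. x \<notin> (\<Union>n. C n) \<Longrightarrow> u x = x"
    by (rule glue_permutations[OF assms]) blast
  have "u ` C n = C n" for n
    using bij_betw_imp_surj_on[OF assms(2)[of n]] u(2)[of _ n] by (simp cong: image_cong)
  then have "u \<in> Sym_fam C" using u(1,3) unfolding Sym_fam_def Sym_def by blast
  then show ?thesis using u(2) that by blast
qed

lemma gen_by_bij:
  assumes "X \<subseteq> Sym" "g \<in> gen_by X"
  shows "bij g"
  using assms(2)
  by induction (use assms(1) in \<open>auto simp: Sym_def simp del: o_apply id_apply intro: bij_id bij_comp bij_imp_bij_inv\<close>)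

text \<open>Bounding the index of the admitted generators by \<open>k\<close> keeps the graph locally finite although
  there may be infinitely many generators \<open>c i\<close>.\<close>

definition step_rel :: "('a \<Rightarrow> 'a) set \<Rightarrow> (nat \<Rightarrow> 'a \<Rightarrow> 'a) \<Rightarrow> nat \<Rightarrow> ('a \<times> 'a) set" where
  "step_rel P c k = Id \<union> {(x, h x) | x h. h \<in> P} \<union> {(x, c i x) | x i. i \<le> k} \<union> {(c i x, x) | x i. i \<le> k}"

lemma sym_step_rel:
  assumes "is_subgroup P"
  shows "sym (step_rel P c k)"
proof (rule symI)
  fix x y assume "(x, y) \<in> step_rel P c k"
  moreover have "\<exists>h'\<in>P. x = h' (h x)" if "h \<in> P" for h
    using is_subgroupD(1,4)[OF assms that] by (metis bij_inv_eq_iff)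
  ultimately show "(y, x) \<in> step_rel P c k" unfolding step_rel_def by blast
qed

lemma sym_relpow:
  fixes R :: "('a \<times> 'a) set"
  shows "sym R \<Longrightarrow> sym (R ^^ n)"
proof (induction n)
  case (Suc n)
  then have "(R ^^ Suc n)\<inverse> = R ^^ Suc n"
    by (simp add: converse_relcomp sym_conv_converse_eq relpow_commute)
  then show ?case by (simp only: sym_conv_converse_eq)
qed (simp add: sym_Id)

lemma step_rel_mono: "j \<le> k \<Longrightarrow> step_rel P c j \<subseteq> step_rel P c k"
  unfolding step_rel_def by (intro Un_mono subset_refl) (blast intro: order_trans)+

lemma relpow_mono_rel:
  fixes R S :: "('a \<times> 'a) set"
  shows "R \<subseteq> S \<Longrightarrow> R ^^ n \<subseteq> S ^^ n"
  by (induction n) auto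

lemma gen_by_displacement:
  assumes P: "is_subgroup P" and c: "\<And>i. bij (c i)" and g: "g \<in> gen_by (P \<union> range c)"
  shows "\<exists>k. \<forall>x. (x, g x) \<in> step_rel P c k ^^ k"
  using g
proof induction
  case gen_id
  show ?case by (rule exI[of _ 0]) simp
next
  case (gen_base f)
  \<comment> \<open>Loops from \<open>Id\<close> pad a single step to a path of length
    \<open>Suc k\<close>, since length and index bound have to coincide.\<close>
  have step: "S \<subseteq> step_rel P c k ^^ Suc k" if "S \<subseteq> step_rel P c k" for S k
  proof -
    have "Id ^^ k \<subseteq> step_rel P c k ^^ k" by (rule relpow_mono_rel) (auto simp: step_rel_def)
    moreover have "Id ^^ k = (Id :: ('a \<times> 'a) set)" by (induction k) auto
    ultimately show ?thesis using that by (auto simp: relcomp_unfold)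
  qed
  from gen_base consider "f \<in> P" | i where "f = c i" by blast
  then obtain k where k: "\<And>x. (x, f x) \<in> step_rel P c k"
    by cases (auto simp: step_rel_def)
  then have "(x, f x) \<in> step_rel P c k ^^ Suc k" for x using step[of "{(x, f x)}"] by blast
  moreover have "step_rel P c k ^^ Suc k \<subseteq> step_rel P c (Suc k) ^^ Suc k"
    by (intro relpow_mono_rel step_rel_mono) simp
  ultimately show ?case by blast
next
  case (gen_comp f g)
  then obtain k l where kl: "\<And>x. (x, f x) \<in> step_rel P c k ^^ k" "\<And>x. (x, g x) \<in> step_rel P c l ^^ l"
    by blast
  have "(x, f (g x)) \<in> step_rel P c (l + k) ^^ (l + k)" for x
  proof -
    have "(x, g x) \<in> step_rel P c (l + k) ^^ l"
      using relpow_mono_rel[OF step_rel_mono[of l "l + k"]] kl(2)[of x] by (meson le_add1 subsetD)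
    moreover have "(g x, f (g x)) \<in> step_rel P c (l + k) ^^ k"
      using relpow_mono_rel[OF step_rel_mono[of k "l + k"]] kl(1)[of "g x"] by (meson le_add2 subsetD)
    ultimately show ?thesis unfolding relpow_add by blast
  qed
  then show ?case by (auto simp del: relpow.simps)
next
  case (gen_inv f)
  then obtain k where k: "\<And>x. (x, f x) \<in> step_rel P c k ^^ k" by blast
  have "P \<union> range c \<subseteq> Sym" using P c by (auto simp: is_subgroup_def Sym_def)
  then have "bij f" using gen_by_bij gen_inv.hyps by blast
  then have "(x, inv f x) \<in> step_rel P c k ^^ k" for x
    using k[of "inv f x"] sym_relpow[OF sym_step_rel[OF P]]
    by (metis bij_inv_eq_iff symD)
  then show ?case by blast
qed

lemma card_relpow_Image_le:
  fixes R :: "('a \<times> 'a) set"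
  assumes "\<And>x. finite (R `` {x}) \<and> card (R `` {x}) \<le> N"
  shows "finite ((R ^^ k) `` {x}) \<and> card ((R ^^ k) `` {x}) \<le> N ^ k"
proof (induction k)
  case (Suc k)
  have eq: "(R ^^ Suc k) `` {x} = (\<Union>y\<in>(R ^^ k) `` {x}. R `` {y})" by auto
  have "card (\<Union>y\<in>(R ^^ k) `` {x}. R `` {y}) \<le> (\<Sum>y\<in>(R ^^ k) `` {x}. card (R `` {y}))"
    using Suc by (intro card_UN_le) auto
  also have "\<dots> \<le> card ((R ^^ k) `` {x}) * N"
    using sum_bounded_above[of "(R ^^ k) `` {x}" "\<lambda>y. card (R `` {y})" N] assms by simp
  also have "\<dots> \<le> N ^ Suc k" using Suc by simp
  finally show ?case using Suc assms unfolding eq by auto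
qed simp

lemma finite_relpow_Image:
  fixes R :: "('a \<times> 'a) set"
  assumes "\<And>x. finite (R `` {x})"
  shows "finite ((R ^^ k) `` {x})"
proof (induction k)
  case (Suc k)
  have "(R ^^ Suc k) `` {x} = (\<Union>y\<in>(R ^^ k) `` {x}. R `` {y})" by auto
  then show ?case using Suc assms by simp
qed simp

lemma step_rel_Image:
  assumes "\<And>i. bij (c i)"
  shows "step_rel P c k `` {x} =
    insert x (orbit_of P x) \<union> ((\<lambda>i. c i x) ` {..k} \<union> (\<lambda>i. inv (c i) x) ` {..k})"
proof -
  have "x = c i y \<longleftrightarrow> y = inv (c i) x" for i y
    using assms by (metis bij_inv_eq_iff)
  then show ?thesis unfolding step_rel_def orbit_of_def by auto
qed

lemma card_step_rel_Image:
  assumes "\<And>i. bij (c i)" "finite (orbit_of P x)"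
  shows "finite (step_rel P c k `` {x})"
    "card (step_rel P c k `` {x}) \<le> card (orbit_of P x) + 2 * k + 3"
proof -
  let ?A = "insert x (orbit_of P x)" and ?B = "(\<lambda>i. c i x) ` {..k}" and ?C = "(\<lambda>i. inv (c i) x) ` {..k}"
  show "finite (step_rel P c k `` {x})"
    using assms(2) unfolding step_rel_Image[OF assms(1)] by simp
  have "card (?A \<union> (?B \<union> ?C)) \<le> card ?A + (card ?B + card ?C)"
    using card_Un_le[of ?A "?B \<union> ?C"] card_Un_le[of ?B ?C] by linarith
  moreover have "card ?A \<le> Suc (card (orbit_of P x))" by (rule card_insert_le_m1) auto
  moreover have "card ?B \<le> Suc k" "card ?C \<le> Suc k"
    using card_image_le[of "{..k}"] by (metis card_atMost finite_atMost)+
  ultimately show "card (step_rel P c k `` {x}) \<le> card (orbit_of P x) + 2 * k + 3"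
    unfolding step_rel_Image[OF assms(1)] by linarith
qed

lemma finite_orbit_Sym_part:
  assumes "finite_block_partition A"
  shows "finite (orbit_of (Sym_part A) x)"
proof -
  obtain B where B: "B \<in> A" "x \<in> B" using finite_block_partitionD(1)[OF assms] by blast
  then have "orbit_of (Sym_part A) x \<subseteq> B" by (auto simp: orbit_of_def Sym_part_def)
  then show ?thesis using finite_block_partitionD(2)[OF assms B(1)] finite_subset by blast
qed

section \<open>Limits in closed groups and obstructions to \<open>preceq\<close>\<close>

text \<open>The maps \<open>g n\<close> are frozen on an exhausting chain, so they converge
  pointwise. Injectivity passes to the limit, but surjectivity does not do so by itself: each
  \<open>y\<close> must have its preimage frozen at some stage, which is the condition
  \<open>surj\<close>. The limit agrees with some \<open>g n\<close> on every finite set, so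
  closedness puts it into \<open>G\<close>.\<close>

lemma closed_limit:
  assumes G: "is_subgroup G" "closed_in_Sym G" and g: "\<And>n. g n \<in> G"
    and \<Delta>: "\<And>n. \<Delta> n \<subseteq> \<Delta> (Suc n)" "\<And>x. \<exists>n. x \<in> \<Delta> n"
    and agree: "\<And>n x. x \<in> \<Delta> n \<Longrightarrow> g (Suc n) x = g n x"
    and surj: "\<And>y. \<exists>n. inv (g n) y \<in> \<Delta> n"
  obtains l where "l \<in> G" "\<And>n x. x \<in> \<Delta> n \<Longrightarrow> l x = g n x"
proof -
  have mono: "\<Delta> m \<subseteq> \<Delta> n" if "m \<le> n" for m n using \<Delta>(1) that by (rule lift_Suc_mono_le)
  have agree': "g n x = g m x" if "m \<le> n" "x \<in> \<Delta> m" for m n x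
    using that
  proof (induction n rule: dec_induct)
    case (step n)
    then show ?case using agree mono by (metis subsetD)
  qed simp
  define l where "l x = g (LEAST n. x \<in> \<Delta> n) x" for x
  have l: "l x = g n x" if "x \<in> \<Delta> n" for x n
    unfolding l_def
    by (rule agree'[symmetric]) (use that in \<open>auto intro: Least_le LeastI\<close>)
  have cover: "\<exists>n. F \<subseteq> \<Delta> n" if "finite F" for F
    using that
  proof induction
    case (insert x F)
    then obtain m n where "F \<subseteq> \<Delta> m" "x \<in> \<Delta> n" using \<Delta>(2) by blast
    then have "insert x F \<subseteq> \<Delta> (max m n)" using mono[of m "max m n"] mono[of n "max m n"] by auto
    then show ?case by blast
  qed simp
  have bij: "bij (g n)" for n using is_subgroupD(1)[OF G(1) g] .
  have "bij l"
  proof (rule bijI)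
    show "inj l"
    proof (rule injI)
      fix x y assume eq: "l x = l y"
      obtain n where "{x, y} \<subseteq> \<Delta> n" using cover[of "{x, y}"] by auto
      then show "x = y" using eq l[of x n] l[of y n] bij[of n] by (simp add: bij_is_inj inj_eq)
    qed
    show "surj l"
    proof (rule surjI)
      fix y
      define n where "n = (SOME n. inv (g n) y \<in> \<Delta> n)"
      have "inv (g n) y \<in> \<Delta> n" unfolding n_def using surj[of y] by (rule someI_ex)
      then show "l (inv (g (SOME n. inv (g n) y \<in> \<Delta> n)) y) = y"
        using l[of "inv (g n) y" n] bij[of n] unfolding n_def[symmetric] by (simp add: bij_is_surj surj_f_inv_f)
    qed
  qed
  moreover have "\<exists>h\<in>G. \<forall>x\<in>F. h x = l x" if "finite F" for F
    using cover[OF that] l g by (metis subsetD)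
  ultimately have "l \<in> G" using G(2) unfolding closed_in_Sym_def Sym_def by simp
  then show ?thesis using that l by blast
qed

text \<open>A diagonal argument: if the stabilizer of every finite set has an infinite orbit, then a
  limit of elements of \<open>G\<close> can be built that violates, for each \<open>n\<close>, the
  displacement bound with parameter \<open>n\<close>. No word in \<open>Sym_part A\<close> and
  finitely many permutations does so, because finite blocks make the balls finite.\<close>

lemma preceq_Sym_part_imp_finite_orbits:
  fixes G :: "('a::countable \<Rightarrow> 'a) set"
  assumes G: "is_subgroup G" "closed_in_Sym G" and A: "finite_block_partition A"
    and le: "preceq G (Sym_part A)"
  shows "\<exists>\<Gamma>. finite \<Gamma> \<and> (\<forall>x. finite (orbit_of (pstab G \<Gamma>) x))"
proof (rule ccontr)
  assume "\<not> ?thesis"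
  then have unb: "\<exists>x. infinite (orbit_of (pstab G \<Gamma>) x)" if "finite \<Gamma>" for \<Gamma> using that by blast
  obtain U where U: "finite U" "U \<subseteq> Sym" "G \<subseteq> gen_by (Sym_part A \<union> U)"
    using le unfolding preceq_def by blast
  \<comment> \<open>\<open>id\<close> is added so that the enumerated set is nonempty even for empty
    \<open>U\<close>.\<close>
  define c where "c = from_nat_into (insert id U)"
  have rc: "range c = insert id U"
    unfolding c_def by (rule range_from_nat_into) (use U(1) in \<open>auto intro: countable_finite\<close>)
  have "c i \<in> insert id U" for i using rc by blast
  then have bc: "bij (c i)" for i using U(2) unfolding Sym_def by (metis bij_id insertE mem_Collect_eq subsetD)
  define ball where "ball n x = (step_rel (Sym_part A) c n ^^ n) `` {x}" for n x
  have fin: "finite (ball n x)" for n x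
    unfolding ball_def by (intro finite_relpow_Image card_step_rel_Image(1) bc finite_orbit_Sym_part A)
  \<comment> \<open>The state is a group element with the finite set on which it is frozen. Stage
    \<open>n\<close> also freezes the point numbered \<open>n\<close> and its preimage, so that the
    limit is total and surjective, and a point leaving its ball with parameter
    \<open>n\<close>.\<close>
  have "\<exists>s. \<forall>n. (fst (s n) \<in> G \<and> finite (snd (s n))) \<and>
      ((\<forall>x\<in>snd (s n). fst (s (Suc n)) x = fst (s n) x) \<and> snd (s n) \<subseteq> snd (s (Suc n)) \<and>
       {from_nat n, inv (fst (s (Suc n))) (from_nat n)} \<subseteq> snd (s (Suc n)) \<and>
       (\<exists>x\<in>snd (s (Suc n)). fst (s (Suc n)) x \<notin> ball n x))"
  proof (rule dependent_nat_choice, goal_cases)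
    case 1
    show ?case using is_subgroupD(2)[OF G(1)] by (intro exI[of _ "(id, {})"]) (simp del: id_apply)
  next
    case (2 s n)
    obtain g \<Gamma> where s: "s = (g, \<Gamma>)" by fastforce
    have g: "g \<in> G" and \<Gamma>: "finite \<Gamma>" using 2 s by auto
    obtain x where x: "infinite (orbit_of (pstab G \<Gamma>) x)" using unb[OF \<Gamma>] by blast
    \<comment> \<open>An infinite set does not fit into a finite ball; and \<open>h\<close> fixes
      \<open>\<Gamma>\<close>, so \<open>g \<circ> h\<close> still agrees with \<open>g\<close>
      there.\<close>
    have "infinite (g ` orbit_of (pstab G \<Gamma>) x)"
      using x is_subgroupD(1)[OF G(1) g] by (metis bij_is_inj finite_imageD inj_on_subset subset_UNIV)
    then obtain h where h: "h \<in> pstab G \<Gamma>" "g (h x) \<notin> ball n x"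
      using fin[of n x] unfolding orbit_of_def by (smt (verit) finite_subset imageE mem_Collect_eq subsetI)
    define g' where "g' = g \<circ> h"
    have "g' \<in> G" using g h(1) is_subgroupD(3)[OF G(1)] by (simp add: g'_def pstab_def)
    moreover have "\<forall>y\<in>\<Gamma>. g' y = g y" "g' x \<notin> ball n x" using h by (simp_all add: g'_def pstab_def)
    ultimately show ?case
      using \<Gamma> unfolding s
      by (intro exI[of _ "(g', \<Gamma> \<union> {x, from_nat n, inv g' (from_nat n)})"]) auto
  qed
  then obtain s where s: "\<And>n. fst (s n) \<in> G"
      "\<And>n x. x \<in> snd (s n) \<Longrightarrow> fst (s (Suc n)) x = fst (s n) x" "\<And>n. snd (s n) \<subseteq> snd (s (Suc n))"
      "\<And>n. from_nat n \<in> snd (s (Suc n))" "\<And>n. inv (fst (s (Suc n))) (from_nat n) \<in> snd (s (Suc n))"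
      "\<And>n. \<exists>x\<in>snd (s (Suc n)). fst (s (Suc n)) x \<notin> ball n x"
    by auto
  have "\<exists>n. x \<in> snd (s n)" "\<exists>n. inv (fst (s n)) x \<in> snd (s n)" for x
    using s(4)[of "to_nat x"] s(5)[of "to_nat x"] by auto
  then obtain l where l: "l \<in> G" "\<And>n x. x \<in> snd (s n) \<Longrightarrow> l x = fst (s n) x"
    using closed_limit[OF G, of "\<lambda>n. fst (s n)" "\<lambda>n. snd (s n)"] s(1-3) by blast
  have "Sym_part A \<union> U \<subseteq> Sym_part A \<union> range c" unfolding rc by blast
  then have "l \<in> gen_by (Sym_part A \<union> range c)" using l(1) U(3) gen_by_mono by blast
  then obtain k where "\<And>x. l x \<in> ball k x"
    using gen_by_displacement[where c = c, OF is_subgroup_Sym_part bc] unfolding ball_def by blast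
  then show False using s(6)[of k] l(2)[of _ "Suc k"] by metis
qed

text \<open>A left coset of the stabilizer is determined by the values on the finite set
  \<open>\<Gamma>\<close>, and tuples of values over a countable type are coded by natural
  numbers.\<close>

lemma coset_enumeration:
  fixes G :: "('a::countable \<Rightarrow> 'a) set"
  assumes G: "is_subgroup G" and "finite \<Gamma>"
  shows "\<exists>c :: nat \<Rightarrow> 'a \<Rightarrow> 'a. (\<forall>i. c i \<in> G) \<and> (\<forall>g\<in>G. \<exists>i. \<exists>h\<in>pstab G \<Gamma>. g = c i \<circ> h)"
proof -
  obtain xs where xs: "set xs = \<Gamma>" using finite_list[OF assms(2)] by blast
  define R where "R i g \<longleftrightarrow> g \<in> G \<and> map g xs = from_nat i" for i g
  \<comment> \<open>Codes that no element of \<open>G\<close> has get \<open>id\<close>, so that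
    every \<open>c i\<close> lies in \<open>G\<close>.\<close>
  define c where "c i = (if \<exists>g. R i g then SOME g. R i g else id)" for i
  have c: "R i (c i)" if "R i g" for i g
    using that someI[of "R i"] unfolding c_def by auto
  have cG: "c i \<in> G" for i
    using c[of i] is_subgroupD(2)[OF G] unfolding R_def by (cases "\<exists>g. R i g") (auto simp: c_def R_def)
  have "\<exists>i. \<exists>h\<in>pstab G \<Gamma>. g = c i \<circ> h" if g: "g \<in> G" for g
  proof -
    define i where "i = to_nat (map g xs)"
    have "R i g" using g by (simp add: R_def i_def)
    then have "R i (c i)" by (rule c)
    then have eq: "map (c i) xs = map g xs" unfolding R_def i_def by simp
    have bi: "bij (c i)" using is_subgroupD(1)[OF G cG] .
    have "inv (c i) \<circ> g \<in> G" using g cG is_subgroupD(3,4)[OF G] by blast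
    moreover have "inv (c i) (g x) = x" if "x \<in> \<Gamma>" for x
    proof -
      have "g x = c i x" using eq that xs by simp
      then show ?thesis using bi by (simp add: bij_is_inj)
    qed
    ultimately have "inv (c i) \<circ> g \<in> pstab G \<Gamma>" by (simp add: pstab_def)
    moreover have "g = c i \<circ> (inv (c i) \<circ> g)"
      using bi by (simp add: fun_eq_iff bij_is_surj surj_f_inv_f)
    ultimately show ?thesis by blast
  qed
  then show ?thesis using cG by (intro exI[of _ c]) simp
qed

text \<open>\<open>G\<close> is generated by the stabilizer \<open>P\<close> and countably many
  coset representatives. With these generators and \<open>U\<close>, the ball with parameter
  \<open>k\<close> has at most \<open>N k\<close> points, uniformly in its centre. But
  \<open>Sym_part A\<close> contains a single permutation that, for every \<open>k\<close>, moves
  some point of a large block out of its ball.\<close>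

lemma bounded_orbits_not_Sym_part_preceq:
  fixes G :: "('a::countable \<Rightarrow> 'a) set"
  assumes G: "is_subgroup G" and \<Gamma>: "finite \<Gamma>"
    and bd: "\<And>x. finite (orbit_of (pstab G \<Gamma>) x) \<and> card (orbit_of (pstab G \<Gamma>) x) \<le> n"
    and A: "A \<in> unbounded_partitions"
  shows "\<not> preceq (Sym_part A) G"
proof
  assume "preceq (Sym_part A) G"
  then obtain U where U: "finite U" "U \<subseteq> Sym" "Sym_part A \<subseteq> gen_by (G \<union> U)"
    unfolding preceq_def by blast
  define P where "P = pstab G \<Gamma>"
  have P: "is_subgroup P" unfolding P_def by (rule is_subgroup_pstab[OF G])
  obtain d :: "nat \<Rightarrow> 'a \<Rightarrow> 'a" where d: "\<forall>i. d i \<in> G" "\<forall>g\<in>G. \<exists>i. \<exists>h\<in>P. g = d i \<circ> h"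
    using coset_enumeration[OF G \<Gamma>, folded P_def] by blast
  define c where "c = from_nat_into (range d \<union> U)"
  have rc: "range c = range d \<union> U"
    unfolding c_def by (rule range_from_nat_into) (use U(1) in \<open>auto intro: countable_finite\<close>)
  have "c i \<in> Sym" for i
  proof -
    have "c i \<in> range d \<union> U" using rc by blast
    moreover have "d j \<in> Sym" for j using d(1) is_subgroupD(1)[OF G] by (simp add: Sym_def)
    ultimately show ?thesis using U(2) by auto
  qed
  then have bc: "bij (c i)" for i by (simp add: Sym_def)
  have "G \<subseteq> gen_by (P \<union> range c)"
  proof
    fix g assume "g \<in> G"
    then obtain i h where "h \<in> P" "g = d i \<circ> h" using d(2) by blast
    then show "g \<in> gen_by (P \<union> range c)"
      unfolding rc using gen_by.gen_comp[OF gen_by.gen_base[of "d i"] gen_by.gen_base[of h]] by simp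
  qed
  then have "G \<union> U \<subseteq> gen_by (P \<union> range c)" unfolding rc by (auto intro: gen_by.gen_base)
  from gen_by_subset[OF this] U(3) have SA: "Sym_part A \<subseteq> gen_by (P \<union> range c)" by blast
  define ball where "ball k x = (step_rel P c k ^^ k) `` {x}" for k x
  define N where "N k = (n + 2 * k + 3) ^ k" for k
  have ball: "finite (ball k x)" "card (ball k x) \<le> N k" for k x
  proof -
    have "finite (step_rel P c k `` {y}) \<and> card (step_rel P c k `` {y}) \<le> n + 2 * k + 3" for y
      using card_step_rel_Image[where c = c and P = P and x = y and k = k, OF bc] bd[of y] unfolding P_def by force
    from card_relpow_Image_le[OF this] show "finite (ball k x)" "card (ball k x) \<le> N k"
      unfolding ball_def N_def by blast+
  qed
  obtain C where C: "disjoint_family C" "\<And>n. finite (C n)" "\<And>n. card (C n) \<ge> n" "Sym_fam C \<subseteq> Sym_part A"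
    by (rule Sym_fam_subset_Sym_part[OF A]) blast
  \<comment> \<open>As \<open>m\<close> is injective, each block \<open>C (m k)\<close> serves one
    \<open>k\<close> only; as \<open>m k\<close> exceeds \<open>N k\<close>, the block does not fit
    into a ball with parameter \<open>k\<close>.\<close>
  define m where "m k = (\<Sum>j\<le>k. Suc (N j))" for k
  have "strict_mono m" by (rule strict_mono_Suc_iff[THEN iffD2]) (auto simp: m_def)
  then have minj: "m j = m k \<Longrightarrow> j = k" for j k by (simp add: strict_mono_eq)
  have mge: "N k < m k" for k
    unfolding m_def by (subst less_eq_Suc_le, rule member_le_sum[of k]) auto
  have "\<exists>\<rho>. bij_betw \<rho> (C i) (C i) \<and> (\<forall>k. i = m k \<longrightarrow> (\<exists>x\<in>C i. \<rho> x \<notin> ball k x))" for i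
  proof (cases "i \<in> range m")
    case True
    then obtain k where k: "i = m k" by blast
    have lt: "N k < card (C i)" using mge[of k] C(3)[of i] k by simp
    then obtain x where x: "x \<in> C i" by fastforce
    have "\<not> C i \<subseteq> ball k x"
      using lt card_mono[OF ball(1)[of k x], of "C i"] ball(2)[of k x] by linarith
    then obtain y where y: "y \<in> C i" "y \<notin> ball k x" by blast
    have "bij_betw (Transposition.transpose x y) (C i) (C i)"
      using x y(1) by (intro bij_betwI[of _ _ _ "Transposition.transpose x y"]) (auto simp: Transposition.transpose_def)
    moreover have "Transposition.transpose x y x \<notin> ball k x" using y by simp
    ultimately show ?thesis using x k minj by blast
  next
    case False
    then show ?thesis by (intro exI[of _ id]) (auto simp: bij_betw_def)
  qed
  then obtain \<rho> where \<rho>: "\<And>i. bij_betw (\<rho> i) (C i) (C i)" "\<And>k. \<exists>x\<in>C (m k). \<rho> (m k) x \<notin> ball k x"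
    by metis
  obtain u where u: "u \<in> Sym_fam C" "\<And>n x. x \<in> C n \<Longrightarrow> u x = \<rho> n x"
    by (rule glue_Sym_fam[OF C(1) \<rho>(1)]) blast
  then have "u \<in> gen_by (P \<union> range c)" using C(4) SA by blast
  then obtain k where "\<And>x. u x \<in> ball k x"
    using gen_by_displacement[where c = c, OF P bc] unfolding ball_def by blast
  then show False using \<rho>(2)[of k] u(2)[of _ "m k"] by metis
qed

section \<open>Groups with finite orbits\<close>

lemma preceq_Un:
  assumes "preceq G1 H" "preceq G2 H"
  shows "preceq (G1 \<union> G2) H"
proof -
  obtain U V where U: "finite U" "U \<subseteq> Sym" "G1 \<subseteq> gen_by (H \<union> U)"
    and V: "finite V" "V \<subseteq> Sym" "G2 \<subseteq> gen_by (H \<union> V)"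
    using assms unfolding preceq_def by blast
  have "G1 \<union> G2 \<subseteq> gen_by (H \<union> (U \<union> V))"
    using U(3) V(3) gen_by_mono[of "H \<union> U" "H \<union> (U \<union> V)"] gen_by_mono[of "H \<union> V" "H \<union> (U \<union> V)"]
    by blast
  then show ?thesis unfolding preceq_def using U V by (intro exI[of _ "U \<union> V"]) auto
qed

lemma gen_by_preceq:
  assumes "G \<subseteq> gen_by X" "preceq X H"
  shows "preceq G H"
proof -
  obtain U where U: "finite U" "U \<subseteq> Sym" "X \<subseteq> gen_by (H \<union> U)"
    using assms(2) unfolding preceq_def by blast
  then have "G \<subseteq> gen_by (H \<union> U)" using gen_by_subset[OF U(3)] assms(1) by blast
  then show ?thesis unfolding preceq_def using U by blast
qed

section \<open>Chains of finite sets and permutations that almost preserve them\<close>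

text \<open>The empty set is taken out because consecutive members of a chain may coincide.\<close>

definition layers :: "(nat \<Rightarrow> 'a set) \<Rightarrow> 'a set set" where
  "layers H = range (\<lambda>j. H (Suc j) - H j) - {{}}"

lemma finite_block_partition_layers:
  assumes "\<And>j. finite (H j)" "H 0 = {}" "\<And>j. H j \<subseteq> H (Suc j)" "\<And>x. \<exists>j. x \<in> H j"
  shows "finite_block_partition (layers H)"
proof -
  have mono: "H i \<subseteq> H j" if "i \<le> j" for i j using assms(3) that by (rule lift_Suc_mono_le)
  have "\<exists>B\<in>layers H. x \<in> B" for x
  proof -
    define n where "n = (LEAST j. x \<in> H j)"
    have n: "x \<in> H n" unfolding n_def using assms(4) by (rule LeastI_ex)
    then obtain m where m: "n = Suc m" using assms(2) by (cases n) auto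
    then have "x \<notin> H m" using not_less_Least[of m "\<lambda>j. x \<in> H j"] n_def by simp
    then show ?thesis using n m unfolding layers_def by (intro bexI[of _ "H (Suc m) - H m"]) auto
  qed
  moreover have "(H (Suc i) - H i) \<inter> (H (Suc j) - H j) = {}" if "i < j" for i j
    using mono[of "Suc i" j] that by auto
  then have "(H (Suc i) - H i) \<inter> (H (Suc j) - H j) = {}" if "i \<noteq> j" for i j
    using that by (metis inf_commute linorder_neqE_nat)
  then have "B \<inter> C = {}" if "B \<in> layers H" "C \<in> layers H" "B \<noteq> C" for B C
  proof -
    obtain i j where "B = H (Suc i) - H i" "C = H (Suc j) - H j"
      using \<open>B \<in> _\<close> \<open>C \<in> _\<close> unfolding layers_def by blast
    moreover from this have "i \<noteq> j" using \<open>B \<noteq> C\<close> by auto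
    ultimately show ?thesis using \<open>\<And>i j. i \<noteq> j \<Longrightarrow> _\<close> by simp
  qed
  moreover have "finite B" if "B \<in> layers H" for B using that assms(1) by (auto simp: layers_def)
  moreover have "{} \<notin> layers H" by (simp add: layers_def)
  ultimately show ?thesis unfolding finite_block_partition_def by (intro conjI ballI impI UNIV_eq_I[symmetric]) blast+
qed

lemma Sym_part_layersI:
  assumes "bij f" "\<And>j. f ` H j = H j"
  shows "f \<in> Sym_part (layers H)"
proof -
  have "f ` (H (Suc j) - H j) = H (Suc j) - H j" for j
    using assms(2) by (simp add: image_set_diff[OF bij_is_inj[OF assms(1)]])
  then show ?thesis using assms(1) by (auto simp only: Sym_part_def Sym_def layers_def)
qed

lemma bij_betw_moving_subset:
  assumes "finite X" "A \<subseteq> X" "B \<subseteq> X" "card A = card B"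
  shows "\<exists>\<rho>. bij_betw \<rho> X X \<and> \<rho> ` A = B"
proof -
  have fin: "finite A" "finite B" using assms finite_subset by auto
  obtain p where p: "bij_betw p A B"
    using finite_same_card_bij[OF fin assms(4)] by blast
  have "card (X - A) = card (X - B)" using assms fin by (simp add: card_Diff_subset)
  then obtain q where q: "bij_betw q (X - A) (X - B)"
    using finite_same_card_bij[of "X - A" "X - B"] assms(1) by auto
  define \<rho> where "\<rho> x = (if x \<in> A then p x else q x)" for x
  have 1: "bij_betw \<rho> A B" using p by (subst bij_betw_cong[of _ _ p]) (auto simp: \<rho>_def)
  have "bij_betw \<rho> (X - A) (X - B)" using q by (subst bij_betw_cong[of _ _ q]) (auto simp: \<rho>_def)
  then have "bij_betw \<rho> (A \<union> (X - A)) (B \<union> (X - B))" using 1 by (intro bij_betw_combine) auto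
  moreover have "A \<union> (X - A) = X" "B \<union> (X - B) = X" using assms by auto
  ultimately show ?thesis using 1 by (auto simp: bij_betw_def)
qed

text \<open>Transposing two points of \<open>F (Suc (Suc k)) - F k\<close> disturbs no member of the
  chain except possibly \<open>F (Suc k)\<close>, so it preserves all members whose index has the
  parity of \<open>k\<close>. These double layers overlap, which links any two points through a
  string of such transpositions.\<close>

lemma finitary_in_gen_by:
  fixes F :: "nat \<Rightarrow> 'a set"
  assumes strict: "\<And>k. F k \<subset> F (Suc k)" and F0: "F 0 = {}" and cover: "\<And>x. \<exists>k. x \<in> F k"
    and \<sigma>: "\<sigma> permutes D" "finite D"
  shows "\<sigma> \<in> gen_by (Sym_part (layers (\<lambda>j. F (2 * j))) \<union> Sym_part (layers (\<lambda>j. F (2 * j - 1))))"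
    (is "_ \<in> gen_by ?X")
proof -
  have mono: "F i \<subseteq> F j" if "i \<le> j" for i j using strict by (intro lift_Suc_mono_le[OF _ that]) blast
  let ?t = "Transposition.transpose :: 'a \<Rightarrow> 'a \<Rightarrow> 'a \<Rightarrow> 'a"
  have adjacent: "?t x y \<in> gen_by ?X" if "x \<in> F (Suc (Suc k)) - F k" "y \<in> F (Suc (Suc k)) - F k" for x y k
  proof -
    have *: "?t x y ` F i = F i" if "i \<le> k \<or> Suc (Suc k) \<le> i" for i
      using that \<open>x \<in> _\<close> \<open>y \<in> _\<close> mono[of i k] mono[of "Suc (Suc k)" i] by (intro transpose_image_eq) auto
    have "?t x y \<in> ?X"
    proof (cases "even k")
      case True
      then have "2 * j \<le> k \<or> Suc (Suc k) \<le> 2 * j" for j by presburger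
      then have "?t x y \<in> Sym_part (layers (\<lambda>j. F (2 * j)))" using * by (intro Sym_part_layersI) simp_all
      then show ?thesis by blast
    next
      case False
      then have "2 * j - 1 \<le> k \<or> Suc (Suc k) \<le> 2 * j - 1" for j by presburger
      then have "?t x y \<in> Sym_part (layers (\<lambda>j. F (2 * j - 1)))" using * by (intro Sym_part_layersI) simp_all
      then show ?thesis by blast
    qed
    then show ?thesis by (rule gen_by.gen_base)
  qed
  \<comment> \<open>The product (x y)(y z)(x y) is (x z); the degenerate cases are treated
    apart.\<close>
  have trans: "?t x z \<in> gen_by ?X" if "?t x y \<in> gen_by ?X" "?t y z \<in> gen_by ?X" for x y z
  proof (cases "x = z \<or> y = z")
    case True
    then show ?thesis using that gen_by.gen_id by (auto simp only: transpose_same)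
  next
    case False
    then have "?t x z = ?t x y \<circ> ?t y z \<circ> ?t x y" by (simp add: transpose_comp_triple)
    then show ?thesis using gen_by.gen_comp[OF gen_by.gen_comp[OF that] that(1)] by simp
  qed
  \<comment> \<open>One representative per single layer: \<open>q k\<close> and
    \<open>q (Suc k)\<close> share a double layer, so all layers are linked to
    \<open>q 0\<close>.\<close>
  define q where "q k = (SOME x. x \<in> F (Suc k) - F k)" for k
  have q: "q k \<in> F (Suc k) - F k" for k
    unfolding q_def using strict[of k] by (intro someI_ex[of "\<lambda>x. x \<in> F (Suc k) - F k"]) blast
  have q0: "?t (q 0) (q k) \<in> gen_by ?X" for k
  proof (induction k)
    case 0
    show ?case unfolding transpose_same by (rule gen_by.gen_id)
  next
    case (Suc k)
    have "?t (q k) (q (Suc k)) \<in> gen_by ?X"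
      using q[of k] q[of "Suc k"] mono[of k "Suc k"] mono[of "Suc k" "Suc (Suc k)"] by (intro adjacent[of _ k]) auto
    then show ?case using Suc trans by blast
  qed
  have all0: "?t (q 0) x \<in> gen_by ?X" for x
  proof -
    define n where "n = (LEAST k. x \<in> F k)"
    have n: "x \<in> F n" unfolding n_def using cover by (rule LeastI_ex)
    then obtain m where m: "n = Suc m" using F0 by (cases n) auto
    then have "x \<notin> F m" using not_less_Least[of m "\<lambda>k. x \<in> F k"] n_def by simp
    then have "?t (q m) x \<in> gen_by ?X"
      using q[of m] n m mono[of "Suc m" "Suc (Suc m)"] by (intro adjacent[of _ m]) auto
    then show ?thesis using q0 trans by blast
  qed
  then have all: "?t x y \<in> gen_by ?X" for x y
    using trans[of x "q 0" y] by (simp add: transpose_commute)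
  show ?thesis using \<sigma>
  proof (induction rule: permutes_induct)
    case id
    show ?case by (rule gen_by.gen_id)
  next
    case (swap a b p)
    show ?case by (rule gen_by.gen_comp[OF all swap.IH])
  qed
qed

text \<open>Initial segments of the chain are finite, so \<open>g\<close> moves as many points up across each level as down;
  hence a permutation of the odd layers can undo the crossings of the even levels.\<close>

lemma almost_preserving_chain_in_gen_by:
  fixes F :: "nat \<Rightarrow> 'a set"
  assumes fin: "\<And>k. finite (F k)" and strict: "\<And>k. F k \<subset> F (Suc k)" and F0: "F 0 = {}"
    and cover: "\<And>x. \<exists>k. x \<in> F k"
    and g: "bij g" "\<And>k. k \<ge> k0 \<Longrightarrow> g ` F k \<subseteq> F (Suc k)" "\<And>k. k \<ge> k0 \<Longrightarrow> inv g ` F k \<subseteq> F (Suc k)"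
  shows "g \<in> gen_by (Sym_part (layers (\<lambda>j. F (2 * j))) \<union> Sym_part (layers (\<lambda>j. F (2 * j - 1))))"
    (is "_ \<in> gen_by (Sym_part ?E \<union> Sym_part ?O)")
proof -
  have mono: "F i \<subseteq> F j" if "i \<le> j" for i j using strict by (intro lift_Suc_mono_le[OF _ that]) blast
  \<comment> \<open>From \<open>j0\<close> on, \<open>2 * j - 1\<close> is a true difference and at
    least \<open>k0\<close>, so the hypotheses on \<open>g\<close> apply at the levels
    \<open>2 * j - 1\<close> and \<open>2 * j\<close>.\<close>
  define j0 where "j0 = Suc k0"
  define T where "T j = F (2 * j + 1) - F (2 * j - 1)" for j
  \<comment> \<open>\<open>\<rho> j\<close> carries the part of \<open>F (2 * j)\<close> in the odd
    layer \<open>T j\<close> onto the part there of its preimage under \<open>g\<close>, so that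
    \<open>g\<close> after the glued map preserves \<open>F (2 * j)\<close>.\<close>
  have "\<exists>\<rho>. bij_betw \<rho> (T j) (T j) \<and> \<rho> ` (F (2 * j) - F (2 * j - 1)) = inv g ` F (2 * j) - F (2 * j - 1)"
    if "j \<ge> j0" for j
  proof (rule bij_betw_moving_subset)
    have j: "k0 \<le> 2 * j - 1" "Suc (2 * j - 1) = 2 * j" using that by (auto simp: j0_def)
    \<comment> \<open>The preimage of \<open>F (2 * j)\<close> lies between the two neighbouring odd
      levels. It is finite and as large as \<open>F (2 * j)\<close>, so both have equally many
      points in \<open>T j\<close>.\<close>
    have "g ` F (2 * j - 1) \<subseteq> F (2 * j)" using g(2)[OF j(1)] j(2) by simp
    then have sub: "F (2 * j - 1) \<subseteq> inv g ` F (2 * j)"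
      using g(1) by (metis bij_is_inj image_inv_f_f image_mono)
    have sub2: "inv g ` F (2 * j) \<subseteq> F (2 * j + 1)" using g(3)[of "2 * j"] j(1) by simp
    show "finite (T j)" using fin by (simp add: T_def)
    show "F (2 * j) - F (2 * j - 1) \<subseteq> T j" using mono[of "2 * j" "2 * j + 1"] by (auto simp: T_def)
    show "inv g ` F (2 * j) - F (2 * j - 1) \<subseteq> T j" using sub2 by (auto simp: T_def)
    have "card (inv g ` F (2 * j)) = card (F (2 * j))"
      using bij_imp_bij_inv[OF g(1)] by (intro card_image) (auto simp: bij_def inj_on_def)
    then show "card (F (2 * j) - F (2 * j - 1)) = card (inv g ` F (2 * j) - F (2 * j - 1))"
      using fin sub mono[of "2 * j - 1" "2 * j"] by (simp add: card_Diff_subset)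
  qed
  then obtain \<rho> where \<rho>: "\<And>j. j \<ge> j0 \<Longrightarrow> bij_betw (\<rho> j) (T j) (T j)"
      "\<And>j. j \<ge> j0 \<Longrightarrow> \<rho> j ` (F (2 * j) - F (2 * j - 1)) = inv g ` F (2 * j) - F (2 * j - 1)"
    by metis
  have Tlt: "T i \<inter> T j = {}" if "i < j" for i j
  proof -
    have "2 * i + 1 \<le> 2 * j - 1" using that by simp
    from mono[OF this] show ?thesis by (auto simp: T_def)
  qed
  then have "disjoint_family_on T {j0..}"
    unfolding disjoint_family_on_def by (metis inf_commute linorder_neqE_nat)
  then obtain h where h: "bij h" "\<And>j x. j \<in> {j0..} \<Longrightarrow> x \<in> T j \<Longrightarrow> h x = \<rho> j x"
      "\<And>x. x \<notin> (\<Union>j\<in>{j0..}. T j) \<Longrightarrow> h x = x"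
    by (rule glue_permutations[where \<rho> = \<rho>]) (use \<rho>(1) in auto)
  have hT: "h ` T j = T j" if "j \<ge> j0" for j
    using \<rho>(1)[OF that] h(2)[of j] that by (simp add: bij_betw_def cong: image_cong)
  have h_low: "h x = x" if "x \<in> F (2 * j0 - 1)" for x
  proof (rule h(3), safe)
    fix j assume "j \<ge> j0" "x \<in> T j"
    moreover from this have "2 * j0 - 1 \<le> 2 * j - 1" by (intro diff_le_mono) simp
    ultimately show False using that mono[of "2 * j0 - 1" "2 * j - 1"] by (auto simp: T_def)
  qed
  have hO: "h ` F (2 * j - 1) = F (2 * j - 1)" for j
  proof (cases "j \<le> j0")
    case True
    then have "2 * j - 1 \<le> 2 * j0 - 1" by (intro diff_le_mono) simp
    from mono[OF this] have "h x = x" if "x \<in> F (2 * j - 1)" for x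
      using that h_low by blast
    then show ?thesis by simp
  next
    case False
    then have "j0 \<le> j" by simp
    then show ?thesis
    proof (induction j rule: dec_induct)
      case base
      then show ?case using h_low by simp
    next
      case (step j)
      have "F (2 * Suc j - 1) = F (2 * j - 1) \<union> T j"
        using mono[OF order_trans[OF diff_le_self le_add1], of "2 * j" 1 1] by (auto simp: T_def)
      then show ?case using step hT by (simp add: image_Un)
    qed
  qed
  then have hSO: "h \<in> Sym_part ?O" using h(1) by (intro Sym_part_layersI) simp_all
  define f where "f = g \<circ> h"
  have bf: "bij f" unfolding f_def using g(1) h(1) by (intro bij_comp)
  have fD: "f ` F (2 * j) = F (2 * j)" if "j \<ge> j0" for j
  proof -
    have j: "k0 \<le> 2 * j - 1" "Suc (2 * j - 1) = 2 * j" using that by (auto simp: j0_def)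
    have "g ` F (2 * j - 1) \<subseteq> F (2 * j)" using g(2)[OF j(1)] j(2) by simp
    then have sub: "F (2 * j - 1) \<subseteq> inv g ` F (2 * j)"
      using g(1) by (metis bij_is_inj image_inv_f_f image_mono)
    have eq: "F (2 * j) = F (2 * j - 1) \<union> (F (2 * j) - F (2 * j - 1))"
      using mono[of "2 * j - 1" "2 * j"] by auto
    have "x \<in> T j" if "x \<in> F (2 * j) - F (2 * j - 1)" for x
      using that mono[of "2 * j" "2 * j + 1"] by (auto simp: T_def)
    then have "h ` (F (2 * j) - F (2 * j - 1)) = \<rho> j ` (F (2 * j) - F (2 * j - 1))"
      using h(2)[of j] that by (intro image_cong) auto
    then have "h ` F (2 * j) = F (2 * j - 1) \<union> (inv g ` F (2 * j) - F (2 * j - 1))"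
      using eq hO[of j] \<rho>(2)[OF that] by (metis image_Un)
    also have "\<dots> = inv g ` F (2 * j)" using sub by blast
    finally show ?thesis
      unfolding f_def using g(1) by (metis bij_is_surj image_comp image_f_inv_f)
  qed
  \<comment> \<open>Below level \<open>2 * j0\<close> nothing is known about \<open>f\<close>. It
    preserves the finite set \<open>D\<close>, and its action there is split off as
    \<open>\<sigma>\<close>; what remains is the identity on \<open>D\<close> and preserves every
    even level.\<close>
  define D where "D = F (2 * j0)"
  define \<sigma> where "\<sigma> x = (if x \<in> D then f x else x)" for x
  have fDD: "f ` D = D" using fD[of j0] by (simp add: D_def)
  have \<sigma>: "\<sigma> permutes D"
  proof (rule bij_imp_permutes)
    have "bij_betw f D D" using bf fDD by (metis bij_betw_def inj_on_subset subset_UNIV)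
    then show "bij_betw \<sigma> D D" by (subst bij_betw_cong[of _ _ f]) (auto simp: \<sigma>_def)
  qed (simp add: \<sigma>_def)
  have b\<sigma>: "bij \<sigma>" using \<sigma> by (rule permutes_bij)
  define e where "e = inv \<sigma> \<circ> f"
  have eE: "e ` F (2 * j) = F (2 * j)" for j
  proof (cases "j \<le> j0")
    case True
    have "e x = x" if "x \<in> F (2 * j)" for x
    proof -
      have "x \<in> D" using that mono[of "2 * j" "2 * j0"] True by (auto simp: D_def)
      then have "\<sigma> x = f x" by (simp add: \<sigma>_def)
      then show ?thesis unfolding e_def using b\<sigma> by (metis bij_inv_eq_iff comp_apply)
    qed
    then show ?thesis by simp
  next
    case False
    then have sub: "D \<subseteq> F (2 * j)" unfolding D_def by (intro mono) simp
    have "\<sigma> permutes F (2 * j)" using \<sigma> sub by (rule permutes_subset)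
    then have "inv \<sigma> ` F (2 * j) = F (2 * j)" by (intro permutes_image permutes_inv)
    then show ?thesis unfolding e_def using fD[of j] False by (metis image_comp nat_le_linear)
  qed
  have "bij e" unfolding e_def using b\<sigma> bf by (intro bij_comp bij_imp_bij_inv)
  then have eSE: "e \<in> Sym_part ?E" using eE by (intro Sym_part_layersI) simp_all
  have "g = \<sigma> \<circ> (e \<circ> inv h)"
    unfolding e_def f_def using b\<sigma> h(1) by (simp add: fun_eq_iff bij_is_surj surj_f_inv_f)
  moreover have "\<sigma> \<in> gen_by (Sym_part ?E \<union> Sym_part ?O)"
    using finitary_in_gen_by[OF strict F0 cover \<sigma>] fin by (simp add: D_def)
  ultimately show ?thesis
    using eSE hSO by (metis UnI1 UnI2 gen_by.gen_base gen_by.gen_comp gen_by.gen_inv)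
qed

text \<open>The chain is closed up step by step under the two-step neighbourhoods
  \<open>R k\<close>. An element of \<open>G\<close> is one step in \<open>P\<close> followed by one
  step with some \<open>c i\<close>, so from index \<open>i\<close> on it moves \<open>F k\<close>
  into \<open>F (Suc k)\<close>, and by symmetry so does its inverse.\<close>

lemma finite_orbits_imp_preceq_Sym_part:
  fixes G :: "('a::countable \<Rightarrow> 'a) set"
  assumes inf: "infinite (UNIV :: 'a set)" and G: "is_subgroup G" and \<Gamma>: "finite \<Gamma>"
    and fo: "\<And>x. finite (orbit_of (pstab G \<Gamma>) x)" and A: "A \<in> unbounded_partitions"
  shows "preceq G (Sym_part A)"
proof -
  define P where "P = pstab G \<Gamma>"
  have P: "is_subgroup P" unfolding P_def by (rule is_subgroup_pstab[OF G])
  obtain c :: "nat \<Rightarrow> 'a \<Rightarrow> 'a" where c: "\<forall>i. c i \<in> G" "\<forall>g\<in>G. \<exists>i. \<exists>h\<in>P. g = c i \<circ> h"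
    using coset_enumeration[OF G \<Gamma>, folded P_def] by blast
  have bc: "bij (c i)" for i using c(1) is_subgroupD(1)[OF G] by blast
  define R where "R k = step_rel P c k ^^ 2" for k
  have fR: "finite (R k `` {x})" for k x
    unfolding R_def by (intro finite_relpow_Image card_step_rel_Image(1) bc) (use fo in \<open>simp add: P_def\<close>)
  \<comment> \<open>\<open>from_nat k\<close> makes the chain exhaust the type, and the arbitrary
    new point makes it strictly increasing.\<close>
  define F where "F = rec_nat {} (\<lambda>k X. X \<union> {from_nat k, SOME y. y \<notin> X} \<union> (\<Union>x\<in>X. R k `` {x}))"
  have F0: "F 0 = {}" by (simp add: F_def)
  have FS: "F (Suc k) = F k \<union> {from_nat k, SOME y. y \<notin> F k} \<union> (\<Union>x\<in>F k. R k `` {x})" for k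
    by (simp add: F_def)
  have fin: "finite (F k)" for k by (induction k) (auto simp: F0 FS fR)
  have strict: "F k \<subset> F (Suc k)" for k
  proof -
    have "\<exists>y. y \<notin> F k" using fin[of k] inf by (metis UNIV_eq_I)
    then have "(SOME y. y \<notin> F k) \<notin> F k" by (rule someI_ex)
    then show ?thesis unfolding FS by blast
  qed
  have cover: "\<exists>k. x \<in> F k" for x
    using FS[of "to_nat x"] by (intro exI[of _ "Suc (to_nat x)"]) simp
  have "g \<in> gen_by (Sym_part (layers (\<lambda>j. F (2 * j))) \<union> Sym_part (layers (\<lambda>j. F (2 * j - 1))))"
    if g: "g \<in> G" for g
  proof -
    obtain i h where ih: "h \<in> P" "g = c i \<circ> h" using c(2) g by blast
    have gR: "(x, g x) \<in> R k" if "k \<ge> i" for x k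
    proof -
      have "(x, h x) \<in> step_rel P c k" "(h x, c i (h x)) \<in> step_rel P c k"
        using ih(1) that by (auto simp: step_rel_def)
      then show ?thesis unfolding R_def ih(2) numeral_2_eq_2 by auto
    qed
    have bg: "bij g" using is_subgroupD(1)[OF G g] .
    have "(x, inv g x) \<in> R k" if "k \<ge> i" for x k
      using gR[OF that, of "inv g x"] sym_relpow[OF sym_step_rel[OF P]] bg
      unfolding R_def by (metis bij_inv_eq_iff symD)
    then show ?thesis
      using gR by (intro almost_preserving_chain_in_gen_by[where ?k0.0 = i] fin strict F0 cover bg) (auto simp: FS)
  qed
  moreover have "finite_block_partition (layers (\<lambda>j. F (2 * j)))"
  proof (rule finite_block_partition_layers)
    show "F (2 * j) \<subseteq> F (2 * Suc j)" for j using strict[of "2 * j"] strict[of "Suc (2 * j)"] by auto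
    show "\<exists>j. x \<in> F (2 * j)" for x
    proof -
      obtain k where "x \<in> F k" using cover by blast
      then have "x \<in> F (2 * k)" using lift_Suc_mono_le[of F k "2 * k"] strict by auto
      then show ?thesis by blast
    qed
  qed (use fin F0 in auto)
  moreover have "finite_block_partition (layers (\<lambda>j. F (2 * j - 1)))"
  proof (rule finite_block_partition_layers)
    have mono: "F i \<subseteq> F j" if "i \<le> j" for i j using strict by (intro lift_Suc_mono_le[OF _ that]) blast
    show "F (2 * j - 1) \<subseteq> F (2 * Suc j - 1)" for j by (rule mono) simp
    show "\<exists>j. x \<in> F (2 * j - 1)" for x
    proof -
      obtain k where "x \<in> F k" using cover by blast
      then have "x \<in> F (2 * Suc k - 1)" using mono[of k "2 * Suc k - 1"] by auto
      then show ?thesis by blast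
    qed
  qed (use fin F0 in auto)
  ultimately show ?thesis
    using gen_by_preceq[OF _ preceq_Un[OF Sym_part_preceq_Sym_part[OF inf _ A] Sym_part_preceq_Sym_part[OF inf _ A]]]
    by blast
qed

section \<open>Realizing all permutations of a family of finite sets\<close>

text \<open>\<open>Z\<close> is built one point at a time. A new point with a large orbit under the
  stabilizer of \<open>\<Delta> \<union> Z\<close> can be moved away from at most \<open>N\<close>
  forbidden points without disturbing the images of the earlier points.\<close>

lemma exists_avoidable_set:
  assumes G: "is_subgroup G"
    and unb: "\<forall>\<Delta> N. finite \<Delta> \<longrightarrow> (\<exists>x. N < card (orbit_of (pstab G \<Delta>) x))"
    and \<Delta>: "finite \<Delta>"
  shows "\<exists>Z. finite Z \<and> card Z = m \<and> Z \<inter> \<Delta> = {} \<and>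
    (\<forall>c\<in>G. \<forall>W. finite W \<longrightarrow> card W \<le> N \<longrightarrow> (\<exists>h\<in>pstab G \<Delta>. (c \<circ> h) ` Z \<inter> W = {}))"
proof (induction m)
  case 0
  have "id \<in> pstab G \<Delta>" using is_subgroupD(2)[OF is_subgroup_pstab[OF G]] .
  then show ?case by (intro exI[of _ "{}"]) auto
next
  case (Suc m)
  then obtain Z where Z: "finite Z" "card Z = m" "Z \<inter> \<Delta> = {}"
    and av: "\<forall>c\<in>G. \<forall>W. finite W \<longrightarrow> card W \<le> N \<longrightarrow> (\<exists>h\<in>pstab G \<Delta>. (c \<circ> h) ` Z \<inter> W = {})"
    by (elim exE conjE) (rule that)
  \<comment> \<open>More than \<open>N\<close> points are needed to escape \<open>W\<close>; having
    more than one point also shows that \<open>x\<close> is not in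
    \<open>\<Delta> \<union> Z\<close>.\<close>
  obtain x where x: "Suc N < card (orbit_of (pstab G (\<Delta> \<union> Z)) x)"
    using unb[rule_format, of "\<Delta> \<union> Z" "Suc N"] \<Delta> Z(1) by auto
  have xnot: "x \<notin> \<Delta> \<union> Z"
  proof
    assume "x \<in> \<Delta> \<union> Z"
    then have "orbit_of (pstab G (\<Delta> \<union> Z)) x \<subseteq> {x}" by (auto simp: orbit_of_def pstab_def)
    then have "card (orbit_of (pstab G (\<Delta> \<union> Z)) x) \<le> 1" using card_mono[of "{x}"] by fastforce
    then show False using x by simp
  qed
  have "\<exists>h\<in>pstab G \<Delta>. (c \<circ> h) ` insert x Z \<inter> W = {}" if c: "c \<in> G" and W: "finite W" "card W \<le> N" for c W
  proof -
    obtain h where h: "h \<in> pstab G \<Delta>" "(c \<circ> h) ` Z \<inter> W = {}" using av[rule_format, OF c W] by blast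
    define d where "d = c \<circ> h"
    have dG: "d \<in> G" using c h(1) is_subgroupD(3)[OF G] by (simp add: d_def pstab_def)
    have bd: "bij d" using is_subgroupD(1)[OF G dG] .
    have "card (inv d ` W) \<le> N" using card_image_le[OF W(1), of "inv d"] W(2) by linarith
    then have "\<not> orbit_of (pstab G (\<Delta> \<union> Z)) x \<subseteq> inv d ` W"
      using card_mono[of "inv d ` W" "orbit_of (pstab G (\<Delta> \<union> Z)) x"] W(1) x by auto
    then obtain k where k: "k \<in> pstab G (\<Delta> \<union> Z)" "k x \<notin> inv d ` W" by (auto simp: orbit_of_def)
    have "d (k x) \<notin> W"
    proof
      assume "d (k x) \<in> W"
      then have "inv d (d (k x)) \<in> inv d ` W" by (rule imageI)
      then show False using k(2) bd by (simp add: bij_is_inj)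
    qed
    moreover have "d (k z) \<notin> W" if "z \<in> Z" for z
      using k(1) h(2) that by (auto simp: pstab_def d_def)
    ultimately have "(c \<circ> (h \<circ> k)) ` insert x Z \<inter> W = {}" by (auto simp: d_def)
    moreover have "h \<circ> k \<in> pstab G \<Delta>"
      using h(1) k(1) is_subgroupD(3)[OF G] by (auto simp: pstab_def)
    ultimately show ?thesis by blast
  qed
  then show ?case using Z xnot by (intro exI[of _ "insert x Z"]) auto
qed

text \<open>Greedy choice: each new translate avoids \<open>W\<close> and all earlier translates,
  and \<open>N\<close> bounds the size of that set at every stage.\<close>

lemma disjoint_translates:
  fixes c :: "'i \<Rightarrow> 'a \<Rightarrow> 'a"
  assumes "finite I" "\<And>i. i \<in> I \<Longrightarrow> c i \<in> G" "finite W" "finite Z"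
    and av: "\<And>c W. c \<in> G \<Longrightarrow> finite W \<Longrightarrow> card W \<le> N \<Longrightarrow> \<exists>h\<in>P. (c \<circ> h) ` Z \<inter> W = {}"
    and N: "card W + card I * card Z \<le> N"
  shows "\<exists>h. (\<forall>i\<in>I. h i \<in> P \<and> (c i \<circ> h i) ` Z \<inter> W = {}) \<and> disjoint_family_on (\<lambda>i. (c i \<circ> h i) ` Z) I"
  using assms(1,2) N
proof (induction I)
  case empty
  then show ?case by (simp add: disjoint_family_on_def)
next
  case (insert i I)
  then have "\<exists>h. (\<forall>i\<in>I. h i \<in> P \<and> (c i \<circ> h i) ` Z \<inter> W = {}) \<and> disjoint_family_on (\<lambda>i. (c i \<circ> h i) ` Z) I"
    by simp
  then obtain h where h: "\<And>i. i \<in> I \<Longrightarrow> h i \<in> P \<and> (c i \<circ> h i) ` Z \<inter> W = {}"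
    "disjoint_family_on (\<lambda>i. (c i \<circ> h i) ` Z) I"
    by blast
  define W' where "W' = W \<union> (\<Union>j\<in>I. (c j \<circ> h j) ` Z)"
  have fin: "finite W'" using assms(3,4) insert.hyps(1) by (simp add: W'_def)
  have "card (\<Union>j\<in>I. (c j \<circ> h j) ` Z) \<le> (\<Sum>j\<in>I. card ((c j \<circ> h j) ` Z))"
    by (rule card_UN_le[OF insert.hyps(1)])
  also have "\<dots> \<le> card I * card Z"
    by (rule order_trans[OF sum_bounded_above[OF card_image_le[OF assms(4)]]]) simp
  finally have "card W' \<le> card W + card I * card Z"
    using card_Un_le[of W "\<Union>j\<in>I. (c j \<circ> h j) ` Z"] unfolding W'_def by linarith
  then have "card W' \<le> N" using insert.prems(2) insert.hyps by simp
  then obtain k where k: "k \<in> P" "(c i \<circ> k) ` Z \<inter> W' = {}" using av[OF insert.prems(1)[OF insertI1] fin] by blast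
  define h' where "h' = h(i := k)"
  have h'I: "h' j = h j" if "j \<in> I" for j using that insert.hyps by (auto simp: h'_def)
  have h'i: "h' i = k" by (simp add: h'_def)
  have dj: "(c i \<circ> h' i) ` Z \<inter> (c j \<circ> h' j) ` Z = {}" if "j \<in> I" for j
    using k(2) that unfolding h'i h'I[OF that] W'_def by blast
  have "h' j \<in> P \<and> (c j \<circ> h' j) ` Z \<inter> W = {}" if "j \<in> insert i I" for j
  proof (cases "j = i")
    case True
    then show ?thesis using k unfolding W'_def by (simp only: h'i) blast
  next
    case False
    then have "j \<in> I" using that by simp
    then show ?thesis using h(1) h'I by simp
  qed
  moreover have "disjoint_family_on (\<lambda>i. (c i \<circ> h' i) ` Z) (insert i I)"
    unfolding disjoint_family_on_def
  proof (intro ballI impI)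
    fix a b assume ab: "a \<in> insert i I" "b \<in> insert i I" "a \<noteq> b"
    then consider "a = i" "b \<in> I" | "b = i" "a \<in> I" | "a \<in> I" "b \<in> I" by blast
    then show "(c a \<circ> h' a) ` Z \<inter> (c b \<circ> h' b) ` Z = {}"
    proof cases
      case 1
      then show ?thesis using dj by simp
    next
      case 2
      then show ?thesis using dj[of a] by (simp add: inf_commute)
    next
      case 3
      then show ?thesis using h(2) ab(3) h'I unfolding disjoint_family_on_def by simp
    qed
  qed
  ultimately show ?case by (intro exI[of _ h']) blast
qed

text \<open>With all orbits finite there are only finitely many restrictions of elements of
  \<open>G\<close> to \<open>\<Delta>\<close>, and the restriction determines the coset.\<close>

lemma finite_coset_representatives:
  assumes G: "is_subgroup G" and fo: "\<And>x. finite (orbit_of G x)" and \<Delta>: "finite \<Delta>"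
  shows "\<exists>C. finite C \<and> C \<subseteq> G \<and> (\<forall>g\<in>G. \<exists>c\<in>C. \<exists>k\<in>pstab G \<Delta>. g = c \<circ> k)"
proof -
  define r where "r g = restrict g \<Delta>" for g :: "'a \<Rightarrow> 'a"
  have "r ` G \<subseteq> (\<Pi>\<^sub>E x\<in>\<Delta>. orbit_of G x)" by (auto simp: r_def orbit_of_def)
  moreover have "finite (\<Pi>\<^sub>E x\<in>\<Delta>. orbit_of G x)" using \<Delta> fo by (intro finite_PiE)
  ultimately have fin: "finite (r ` G)" by (rule finite_subset)
  define C where "C = inv_into G r ` (r ` G)"
  have CG: "C \<subseteq> G" unfolding C_def by (auto intro: inv_into_into)
  have "\<exists>c\<in>C. \<exists>k\<in>pstab G \<Delta>. g = c \<circ> k" if g: "g \<in> G" for g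
  proof -
    define c where "c = inv_into G r (r g)"
    have cC: "c \<in> C" using g by (simp add: C_def c_def)
    then have cG: "c \<in> G" using CG by blast
    have "r c = r g" unfolding c_def using g by (simp add: f_inv_into_f)
    then have eq: "c x = g x" if "x \<in> \<Delta>" for x using that by (metis r_def restrict_apply')
    have bc: "bij c" using is_subgroupD(1)[OF G cG] .
    have "inv c \<circ> g \<in> G" using g cG is_subgroupD(3,4)[OF G] by blast
    moreover have "(inv c \<circ> g) x = x" if "x \<in> \<Delta>" for x
      using eq[OF that] bc by (metis bij_inv_eq_iff comp_apply)
    ultimately have "inv c \<circ> g \<in> pstab G \<Delta>" by (simp add: pstab_def)
    moreover have "g = c \<circ> (inv c \<circ> g)" using bc by (simp add: fun_eq_iff bij_is_surj surj_f_inv_f)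
    ultimately show ?thesis using cC by blast
  qed
  then show ?thesis using fin CG by (intro exI[of _ C]) (simp add: C_def)
qed

text \<open>The order of the quantifiers is the point: one finite \<open>V\<close> and one
  \<open>p\<close> must serve all \<open>c\<close> and all \<open>\<pi>\<close>. Since
  \<open>h\<close> can absorb stabilizer elements, only the coset of \<open>c\<close> matters, which
  leaves finitely many pairs. Each pair gets its own translate of \<open>Z\<close>, disjoint from
  the others and from \<open>W\<close>, on which \<open>p\<close> acts as the transported
  permutation.\<close>

lemma realizing_step:
  assumes G: "is_subgroup G" and fo: "\<And>x. finite (orbit_of G x)"
    and unb: "\<forall>\<Delta> N. finite \<Delta> \<longrightarrow> (\<exists>x. N < card (orbit_of (pstab G \<Delta>) x))"
    and \<Delta>: "finite \<Delta>" and W: "finite W"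
  shows "\<exists>Z V p. finite Z \<and> card Z = m \<and> Z \<inter> \<Delta> = {} \<and> finite V \<and> V \<inter> W = {} \<and> bij_betw p V V \<and>
    (\<forall>c\<in>G. \<forall>\<pi>. bij_betw \<pi> Z Z \<longrightarrow>
      (\<exists>h\<in>pstab G \<Delta>. \<forall>z\<in>Z. c (h z) \<in> V \<and> p (c (h z)) = c (h (\<pi> z))))"
proof -
  obtain C where C: "finite C" "C \<subseteq> G" "\<And>g. g \<in> G \<Longrightarrow> \<exists>c\<in>C. \<exists>k\<in>pstab G \<Delta>. g = c \<circ> k"
    using finite_coset_representatives[OF G fo \<Delta>] by blast
  \<comment> \<open>Room for \<open>W\<close> and for one translate of an \<open>m\<close>-element
    set for each of the \<open>card C * fact m\<close> pairs.\<close>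
  define N where "N = card W + (card C * fact m) * m"
  obtain Z where Z: "finite Z" "card Z = m" "Z \<inter> \<Delta> = {}"
    and av: "\<forall>c\<in>G. \<forall>W. finite W \<longrightarrow> card W \<le> N \<longrightarrow> (\<exists>h\<in>pstab G \<Delta>. (c \<circ> h) ` Z \<inter> W = {})"
    using exists_avoidable_set[OF G unb \<Delta>, of m N] by (elim exE conjE) (rule that)
  define I where "I = C \<times> {q. q permutes Z}"
  have finI: "finite I" using C(1) Z(1) by (simp add: I_def finite_permutations)
  have cardI: "card I = card C * fact m"
    using Z(1,2) by (simp add: I_def card_cartesian_product card_permutations)
  have "\<exists>h. (\<forall>i\<in>I. h i \<in> pstab G \<Delta> \<and> (fst i \<circ> h i) ` Z \<inter> W = {}) \<and>
      disjoint_family_on (\<lambda>i. (fst i \<circ> h i) ` Z) I"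
  proof (rule disjoint_translates[where G = G and N = N])
    show "fst i \<in> G" if "i \<in> I" for i using that C(2) by (auto simp: I_def)
    show "card W + card I * card Z \<le> N" by (simp add: N_def cardI Z(2))
  qed (use finI W Z(1) av[rule_format] in auto)
  then obtain h where h: "\<And>i. i \<in> I \<Longrightarrow> h i \<in> pstab G \<Delta>" "\<And>i. i \<in> I \<Longrightarrow> (fst i \<circ> h i) ` Z \<inter> W = {}"
    and dj: "disjoint_family_on (\<lambda>i. (fst i \<circ> h i) ` Z) I"
    by blast
  define g where "g i = fst i \<circ> h i" for i
  have bg: "bij (g i)" if "i \<in> I" for i
  proof -
    have "fst i \<in> G" "h i \<in> G" using that C(2) h(1)[OF that] by (auto simp: I_def pstab_def)
    then show ?thesis unfolding g_def using is_subgroupD(1)[OF G] by (intro bij_comp) auto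
  qed
  define T where "T i = g i ` Z" for i
  have "T = (\<lambda>i. (fst i \<circ> h i) ` Z)" by (simp only: fun_eq_iff T_def g_def simp_thms)
  then have djT: "disjoint_family_on T I" using dj by (simp only:)
  define \<rho> where "\<rho> i = g i \<circ> snd i \<circ> inv (g i)" for i
  have \<rho>: "bij_betw (\<rho> i) (T i) (T i)" if "i \<in> I" for i
  proof -
    have q: "snd i permutes Z" using that by (auto simp: I_def)
    have "bij (\<rho> i)"
      unfolding \<rho>_def using bg[OF that] permutes_bij[OF q] by (intro bij_comp bij_imp_bij_inv)
    moreover have "\<rho> i ` T i = T i"
    proof -
      have "inv (g i) ` g i ` Z = Z" using bg[OF that] by (simp add: bij_is_inj)
      then show ?thesis unfolding \<rho>_def T_def using permutes_image[OF q] by (metis image_comp)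
    qed
    ultimately show ?thesis by (metis bij_betw_def inj_on_subset subset_UNIV)
  qed
  obtain p where p: "bij p" "\<And>i x. i \<in> I \<Longrightarrow> x \<in> T i \<Longrightarrow> p x = \<rho> i x" "\<And>x. x \<notin> (\<Union>i\<in>I. T i) \<Longrightarrow> p x = x"
    by (rule glue_permutations[OF djT \<rho>]; blast)
  define V where "V = (\<Union>i\<in>I. T i)"
  have "bij_betw p V V"
    unfolding V_def
  proof (rule bij_betw_UNION_disjoint)
    show "bij_betw p (T i) (T i)" if "i \<in> I" for i
      using \<rho>[OF that] p(2)[OF that] by (simp cong: bij_betw_cong)
  qed (rule djT)
  moreover have "\<exists>h\<in>pstab G \<Delta>. \<forall>z\<in>Z. c (h z) \<in> V \<and> p (c (h z)) = c (h (\<pi> z))"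
    if c: "c \<in> G" and \<pi>: "bij_betw \<pi> Z Z" for c \<pi>
  proof -
    obtain d k where dk: "d \<in> C" "k \<in> pstab G \<Delta>" "c = d \<circ> k" using C(3)[OF c] by blast
    \<comment> \<open>Replacing \<open>\<pi>\<close> by the identity off \<open>Z\<close> gives a
      permutation that occurs in the index set \<open>I\<close>.\<close>
    define q where "q x = (if x \<in> Z then \<pi> x else x)" for x
    have "bij_betw q Z Z" using \<pi> by (subst bij_betw_cong[of _ _ \<pi>]) (auto simp: q_def)
    then have "q permutes Z" by (rule bij_imp_permutes) (simp add: q_def)
    define i where "i = (d, q)"
    have i: "i \<in> I" using dk(1) \<open>q permutes Z\<close> by (simp add: I_def i_def)
    have bk: "bij k" using dk(2) is_subgroupD(1)[OF G] by (simp add: pstab_def)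
    \<comment> \<open>\<open>inv k\<close> cancels the stabilizer part of \<open>c\<close>, so that
      \<open>c \<circ> h'\<close> is exactly the map \<open>g i\<close> prepared for the pair
      \<open>(d, q)\<close>.\<close>
    define h' where "h' = inv k \<circ> h i"
    have "h' \<in> pstab G \<Delta>"
      unfolding h'_def using is_subgroupD(3,4)[OF is_subgroup_pstab[OF G]] dk(2) h(1)[OF i] by blast
    moreover have ch: "c (h' x) = g i x" for x
      using bk by (simp add: dk(3) h'_def g_def i_def bij_is_surj surj_f_inv_f)
    have "c (h' z) \<in> V \<and> p (c (h' z)) = c (h' (\<pi> z))" if z: "z \<in> Z" for z
    proof -
      have in_T: "g i z \<in> T i" using z by (simp add: T_def)
      have "p (g i z) = g i (q z)"
        using p(2)[OF i in_T] bg[OF i] by (simp add: \<rho>_def i_def bij_is_inj)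
      then show ?thesis using in_T i z by (auto simp: ch V_def q_def)
    qed
    ultimately show ?thesis by blast
  qed
  moreover have "finite V" "V \<inter> W = {}"
    using finI Z(1) h(2) by (auto simp: V_def T_def g_def)
  ultimately show ?thesis using Z by blast
qed

text \<open>\<open>realizing_step\<close> is iterated with disjoint supports, and the maps
  \<open>p n\<close> are glued to \<open>u\<close> before any \<open>\<pi>\<close> is given. For a
  given \<open>\<pi>\<close> the element \<open>g\<close> is then found as a limit, each stage
  adjusting the previous element by some \<open>h\<close> that fixes what is already
  decided.\<close>

lemma realizing_permutation:
  fixes G :: "('a::countable \<Rightarrow> 'a) set" and s :: "nat \<Rightarrow> nat"
  assumes G: "is_subgroup G" "closed_in_Sym G" and fo: "\<And>x. finite (orbit_of G x)"
    and unb: "\<forall>\<Delta> N. finite \<Delta> \<longrightarrow> (\<exists>x. N < card (orbit_of (pstab G \<Delta>) x))"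
  shows "\<exists>Z u. (\<forall>n. finite (Z n) \<and> card (Z n) = s n) \<and> disjoint_family Z \<and> bij u \<and>
    (\<forall>\<pi>. (\<forall>n. bij_betw \<pi> (Z n) (Z n)) \<longrightarrow> (\<exists>g\<in>G. \<forall>n. \<forall>z\<in>Z n. u (g z) = g (\<pi> z)))"
proof -
  define stp where "stp \<Delta> W m Z V p \<longleftrightarrow>
    finite Z \<and> card Z = m \<and> Z \<inter> \<Delta> = {} \<and> finite V \<and> V \<inter> W = {} \<and> bij_betw p V V \<and>
    (\<forall>c\<in>G. \<forall>\<pi>. bij_betw \<pi> Z Z \<longrightarrow>
      (\<exists>h\<in>pstab G \<Delta>. \<forall>z\<in>Z. c (h z) \<in> V \<and> p (c (h z)) = c (h (\<pi> z))))"
    for \<Delta> W m Z V p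
  \<comment> \<open>Three successive choices turn the existence statement into functions of
    \<open>\<Delta>\<close>, \<open>W\<close> and \<open>m\<close>, as the recursion
    requires.\<close>
  define z0 where "z0 \<Delta> W m = (SOME Z. \<exists>V p. stp \<Delta> W m Z V p)" for \<Delta> W m
  define v0 where "v0 \<Delta> W m = (SOME V. \<exists>p. stp \<Delta> W m (z0 \<Delta> W m) V p)" for \<Delta> W m
  define p0 where "p0 \<Delta> W m = (SOME p. stp \<Delta> W m (z0 \<Delta> W m) (v0 \<Delta> W m) p)" for \<Delta> W m
  have stp0: "stp \<Delta> W m (z0 \<Delta> W m) (v0 \<Delta> W m) (p0 \<Delta> W m)" if "finite \<Delta>" "finite W" for \<Delta> W m
  proof -
    have "\<exists>Z V p. stp \<Delta> W m Z V p" using realizing_step[OF G(1) fo unb that] unfolding stp_def by blast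
    then have "\<exists>V p. stp \<Delta> W m (z0 \<Delta> W m) V p" unfolding z0_def by (rule someI_ex)
    then have "\<exists>p. stp \<Delta> W m (z0 \<Delta> W m) (v0 \<Delta> W m) p" unfolding v0_def by (rule someI_ex)
    then show ?thesis unfolding p0_def by (rule someI_ex)
  qed
  \<comment> \<open>\<open>\<Delta>\<close> is the set already decided and \<open>W\<close> the
    support already used. Passing to a union of finite orbits keeps \<open>\<Delta>\<close> finite
    and makes it invariant under \<open>G\<close>; \<open>from_nat n\<close> makes it exhaust the
    type.\<close>
  define st where "st = rec_nat ({}, {}) (\<lambda>n (\<Delta>, W).
    (\<Union>x\<in>insert (from_nat n) (\<Delta> \<union> z0 \<Delta> W (s n)). orbit_of G x, W \<union> v0 \<Delta> W (s n)))"
  define \<Delta> where "\<Delta> n = fst (st n)" for n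
  define W where "W n = snd (st n)" for n
  define Z where "Z n = z0 (\<Delta> n) (W n) (s n)" for n
  define V where "V n = v0 (\<Delta> n) (W n) (s n)" for n
  define p where "p n = p0 (\<Delta> n) (W n) (s n)" for n
  have \<Delta>0: "\<Delta> 0 = {}" and W0: "W 0 = {}" by (simp_all add: \<Delta>_def W_def st_def)
  have \<Delta>S: "\<Delta> (Suc n) = (\<Union>x\<in>insert (from_nat n) (\<Delta> n \<union> Z n). orbit_of G x)"
    and WS: "W (Suc n) = W n \<union> V n" for n
    by (simp_all add: \<Delta>_def W_def Z_def V_def st_def case_prod_unfold)
  have fin: "finite (\<Delta> n) \<and> finite (W n)" for n
  proof (induction n)
    case (Suc n)
    then have "stp (\<Delta> n) (W n) (s n) (Z n) (V n) (p n)" unfolding Z_def V_def p_def by (intro stp0) auto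
    then show ?case using Suc fo by (simp add: \<Delta>S WS stp_def)
  qed (simp add: \<Delta>0 W0)
  have "stp (\<Delta> n) (W n) (s n) (Z n) (V n) (p n)" for n
    unfolding Z_def V_def p_def using fin by (intro stp0) auto
  then have stp: "finite (Z n)" "card (Z n) = s n" "Z n \<inter> \<Delta> n = {}" "V n \<inter> W n = {}" "bij_betw (p n) (V n) (V n)"
    "\<And>c \<pi>. c \<in> G \<Longrightarrow> bij_betw \<pi> (Z n) (Z n) \<Longrightarrow>
      \<exists>h\<in>pstab G (\<Delta> n). \<forall>z\<in>Z n. c (h z) \<in> V n \<and> p n (c (h z)) = c (h (\<pi> z))" for n
    unfolding stp_def by blast+
  have self: "x \<in> orbit_of G x" for x
    using is_subgroupD(2)[OF G(1)] unfolding orbit_of_def by (auto intro!: exI[of _ id])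
  have sub: "insert (from_nat n) (\<Delta> n \<union> Z n) \<subseteq> \<Delta> (Suc n)" for n
    unfolding \<Delta>S using self by blast
  have inv\<Delta>: "g x \<in> \<Delta> (Suc n)" if gx: "g \<in> G" "x \<in> \<Delta> (Suc n)" for g x n
  proof -
    obtain y h where y: "y \<in> insert (from_nat n) (\<Delta> n \<union> Z n)" "h \<in> G" "x = h y"
      using gx(2) unfolding \<Delta>S orbit_of_def by blast
    have "g \<circ> h \<in> G" using gx(1) y(2) is_subgroupD(3)[OF G(1)] by blast
    then have "g x \<in> orbit_of G y" unfolding orbit_of_def y(3) by (auto intro!: exI[of _ "g \<circ> h"])
    then show ?thesis using y(1) unfolding \<Delta>S by blast
  qed
  have mono\<Delta>: "\<Delta> i \<subseteq> \<Delta> j" if "i \<le> j" for i j using sub by (intro lift_Suc_mono_le[OF _ that]) blast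
  have monoW: "W i \<subseteq> W j" if "i \<le> j" for i j using WS by (intro lift_Suc_mono_le[OF _ that]) blast
  have "Z i \<inter> Z j = {}" if "i < j" for i j
    using sub[of i] mono\<Delta>[of "Suc i" j] stp(3)[of j] that by auto
  then have djZ: "disjoint_family Z"
    unfolding disjoint_family_on_def by (metis inf_commute linorder_neqE_nat)
  have "V i \<inter> V j = {}" if "i < j" for i j
    using WS[of i] monoW[of "Suc i" j] stp(4)[of j] that by auto
  then have djV: "disjoint_family V"
    unfolding disjoint_family_on_def by (metis inf_commute linorder_neqE_nat)
  obtain u where u: "bij u" "\<And>n x. x \<in> V n \<Longrightarrow> u x = p n x"
    by (rule glue_permutations[OF djV stp(5)]) blast
  have "\<exists>g\<in>G. \<forall>n. \<forall>z\<in>Z n. u (g z) = g (\<pi> z)" if \<pi>: "\<And>n. bij_betw \<pi> (Z n) (Z n)" for \<pi>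
  proof -
    have "\<exists>g. \<forall>n. g n \<in> G \<and> ((\<forall>x\<in>\<Delta> n. g (Suc n) x = g n x) \<and>
        (\<forall>z\<in>Z n. g (Suc n) z \<in> V n \<and> p n (g (Suc n) z) = g (Suc n) (\<pi> z)))"
    proof (rule dependent_nat_choice, goal_cases)
      case 1
      show ?case using is_subgroupD(2)[OF G(1)] by blast
    next
      case (2 c n)
      obtain h where h: "h \<in> pstab G (\<Delta> n)" "\<forall>z\<in>Z n. c (h z) \<in> V n \<and> p n (c (h z)) = c (h (\<pi> z))"
        using stp(6)[OF 2 \<pi>] by blast
      have "c \<circ> h \<in> G" using 2 h(1) is_subgroupD(3)[OF G(1)] by (simp add: pstab_def)
      moreover have "\<forall>x\<in>\<Delta> n. (c \<circ> h) x = c x" using h(1) by (simp add: pstab_def)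
      moreover have "\<forall>z\<in>Z n. (c \<circ> h) z \<in> V n \<and> p n ((c \<circ> h) z) = (c \<circ> h) (\<pi> z)"
        using h(2) by simp
      ultimately show ?case by blast
    qed
    then obtain g where g: "\<And>n. g n \<in> G" "\<And>n x. x \<in> \<Delta> n \<Longrightarrow> g (Suc n) x = g n x"
      "\<And>n z. z \<in> Z n \<Longrightarrow> g (Suc n) z \<in> V n" "\<And>n z. z \<in> Z n \<Longrightarrow> p n (g (Suc n) z) = g (Suc n) (\<pi> z)"
      by blast
    have in\<Delta>: "x \<in> \<Delta> (Suc (to_nat x))" for x :: 'a using sub[of "to_nat x"] by simp
    \<comment> \<open>Invariance of the sets \<open>\<Delta> (Suc n)\<close> keeps preimages under
      any element of \<open>G\<close> inside, which gives the surjectivity condition of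
      \<open>closed_limit\<close>.\<close>
    have "\<exists>n. inv (g n) y \<in> \<Delta> n" for y
      using inv\<Delta>[OF is_subgroupD(4)[OF G(1) g(1)] in\<Delta>] by blast
    then obtain l where l: "l \<in> G" "\<And>n x. x \<in> \<Delta> n \<Longrightarrow> l x = g n x"
      using closed_limit[OF G, of g \<Delta>] g(1,2) sub in\<Delta> by (metis Un_subset_iff insert_subset)
    have "u (l z) = l (\<pi> z)" if z: "z \<in> Z n" for n z
    proof -
      have "\<pi> z \<in> Z n" using \<pi>[of n] z by (auto simp: bij_betw_def)
      then have "z \<in> \<Delta> (Suc n)" "\<pi> z \<in> \<Delta> (Suc n)" using z sub[of n] by auto
      then have "l z = g (Suc n) z" "l (\<pi> z) = g (Suc n) (\<pi> z)" using l(2) by auto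
      then show ?thesis using g(3,4)[OF z] u(2) by simp
    qed
    then show ?thesis using l(1) by blast
  qed
  then show ?thesis using stp(1,2) djZ u(1) by blast
qed

text \<open>Swindle: on pairs of adjacent copies of a block the commutator of a realized permutation with the
  swap is \<open>(\<sigma>, \<sigma>\<^sup>-\<^sup>1)\<close> and clean elsewhere; multiplying the infinite
  sequence \<open>\<sigma>, \<sigma>\<^sup>-\<^sup>1, \<sigma>, \<sigma>\<^sup>-\<^sup>1, \<dots>\<close> by its shift leaves a single \<open>\<sigma>\<close>.\<close>

lemma Sym_fam_preceq_unbounded_orbits:
  fixes G :: "('a::countable \<Rightarrow> 'a) set"
  assumes G: "is_subgroup G" "closed_in_Sym G" and fo: "\<And>x. finite (orbit_of G x)"
    and unb: "\<forall>\<Delta> N. finite \<Delta> \<longrightarrow> (\<exists>x. N < card (orbit_of (pstab G \<Delta>) x))"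
  shows "\<exists>C :: nat \<Rightarrow> 'a set. disjoint_family C \<and> (\<forall>n. finite (C n) \<and> card (C n) = n) \<and> preceq (Sym_fam C) G"
proof -
  \<comment> \<open>Indices code pairs of a number \<open>k\<close> and an integer, so every size
    \<open>2 * k\<close> occurs for each integer; the factor 2 leaves room for two copies of a
    \<open>k\<close>-element set.\<close>
  define s where "s n = 2 * fst (from_nat n :: nat \<times> int)" for n
  obtain Z :: "nat \<Rightarrow> 'a set" and u where Z: "\<forall>n. finite (Z n) \<and> card (Z n) = s n" "disjoint_family Z" and bu: "bij u"
    and real: "\<forall>\<pi>. (\<forall>n. bij_betw \<pi> (Z n) (Z n)) \<longrightarrow> (\<exists>g\<in>G. \<forall>n. \<forall>z\<in>Z n. u (g z) = g (\<pi> z))"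
    using realizing_permutation[OF G fo unb, of s] by (elim exE conjE) (rule that)
  have "\<exists>b. bij_betw b {0..<s n} (Z n)" for n
    using ex_bij_betw_nat_finite[of "Z n"] Z(1) by auto
  then obtain b where b: "\<And>n. bij_betw (b n) {0..<s n} (Z n)" by metis
  define N where "N k i = to_nat (k :: nat, i :: int)" for k i
  have sN: "s (N k i) = 2 * k" for k i by (simp add: s_def N_def)
  \<comment> \<open>\<open>z k pos j\<close> is point number \<open>j\<close> in copy number
    \<open>pos\<close> of a \<open>k\<close>-element set. The copies \<open>2 * i\<close> and
    \<open>2 * i + 1\<close> are interleaved in \<open>Z (N k i)\<close>; integer positions make the
    shift of copies a bijection.\<close>
  define z where "z k pos j = b (N k (pos div 2)) (2 * j + nat (pos mod 2))" for k :: nat and pos :: int and j :: nat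
  define ZZ where "ZZ = (\<Union>k i. Z (N k i))"
  have lt: "2 * j + nat (pos mod 2) < 2 * k" if "j < k" for j k :: nat and pos :: int
  proof -
    have "nat (pos mod 2) < 2" by linarith
    then show ?thesis using that by linarith
  qed
  have zZ: "z k pos j \<in> Z (N k (pos div 2))" if "j < k" for k pos j
    using bij_betwE[OF b[of "N k (pos div 2)"]] lt[OF that] by (simp add: z_def sN)
  have zZZ: "z k pos j \<in> ZZ" if "j < k" for k pos j using zZ[OF that] by (auto simp: ZZ_def)
  have zinj: "k = k' \<and> pos = pos' \<and> j = j'" if "j < k" "j' < k'" and eq: "z k pos j = z k' pos' j'" for k k' pos pos' j j'
  proof -
    have "N k (pos div 2) = N k' (pos' div 2)"
      using zZ[OF that(1), of pos] zZ[OF that(2), of pos'] eq Z(2) unfolding disjoint_family_on_def by auto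
    then have 1: "k = k'" "pos div 2 = pos' div 2" by (auto simp: N_def)
    have "inj_on (b (N k (pos div 2))) {0..<2 * k}" using b[of "N k (pos div 2)"] by (simp add: sN bij_betw_def)
    then have "2 * j + nat (pos mod 2) = 2 * j' + nat (pos' mod 2)"
      by (rule inj_onD) (use eq 1 lt that in \<open>auto simp: z_def\<close>)
    moreover have "nat (pos mod 2) < 2" "nat (pos' mod 2) < 2" by linarith+
    ultimately have 2: "j = j'" by linarith
    with \<open>2 * j + nat (pos mod 2) = _\<close> have "nat (pos mod 2) = nat (pos' mod 2)" by simp
    then have "pos mod 2 = pos' mod 2" by (simp add: eq_nat_nat_iff)
    then have "pos = pos'" using 1(2) by (metis div_mult_mod_eq)
    then show ?thesis using 1 2 by simp
  qed
  have zsurj: "\<exists>k pos j. j < k \<and> x = z k pos j" if xZZ: "x \<in> ZZ" for x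
  proof -
    obtain k i where x: "x \<in> Z (N k i)" using xZZ by (auto simp: ZZ_def)
    obtain m where m: "m < 2 * k" "x = b (N k i) m"
      using bij_betw_imp_surj_on[OF b[of "N k i"]] x sN by (metis atLeastLessThan_iff imageE)
    have "(2 * i + int (m mod 2)) div 2 = i" "nat ((2 * i + int (m mod 2)) mod 2) = m mod 2" by auto
    moreover have "2 * (m div 2) + m mod 2 = m" by simp
    ultimately have "x = z k (2 * i + int (m mod 2)) (m div 2)" using m(2) by (simp add: z_def)
    moreover have "m div 2 < k" using m(1) by simp
    ultimately show ?thesis by blast
  qed
  define dec where "dec x = (SOME (k, pos, j). j < k \<and> x = z k pos j)" for x
  have dec: "dec (z k pos j) = (k, pos, j)" if "j < k" for k pos j
    unfolding dec_def using that zinj by (intro some_equality) (auto dest: zinj)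
  \<comment> \<open>\<open>f\<close> permutes the copies, while \<open>q k pos\<close> acts inside
    the copy at \<open>pos\<close>; \<open>t\<close>, \<open>v\<close> and \<open>\<pi>\<close>
    below all have this form.\<close>
  define lift where "lift f q x = (if x \<in> ZZ then (case dec x of (k, pos, j) \<Rightarrow> z k (f pos) (q k pos j)) else x)"
    for f :: "int \<Rightarrow> int" and q :: "nat \<Rightarrow> int \<Rightarrow> nat \<Rightarrow> nat" and x
  have lift: "lift f q (z k pos j) = z k (f pos) (q k pos j)" if "j < k" for f q k pos j
    using that zZZ dec by (simp add: lift_def)
  have lift_out: "lift f q x = x" if "x \<notin> ZZ" for f q x using that by (simp add: lift_def)
  have bij_lift: "bij (lift f q)" if f: "bij f" and q: "\<And>k pos. bij_betw (q k pos) {..<k} {..<k}" for f q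
  proof -
    have qlt: "q k pos j < k" if "j < k" for k pos j using bij_betwE[OF q[of k pos]] that by auto
    have in_ZZ: "lift f q x \<in> ZZ \<longleftrightarrow> x \<in> ZZ" for x
    proof (cases "x \<in> ZZ")
      case True
      then obtain k pos j where "j < k" "x = z k pos j" using zsurj by blast
      then show ?thesis using True lift zZZ qlt by simp
    qed (simp add: lift_out)
    have "x = y" if eq: "lift f q x = lift f q y" for x y
    proof (cases "x \<in> ZZ")
      case True
      then have "y \<in> ZZ" using eq in_ZZ by metis
      obtain k pos j where x: "j < k" "x = z k pos j" using zsurj True by blast
      obtain k' pos' j' where y: "j' < k'" "y = z k' pos' j'" using zsurj \<open>y \<in> ZZ\<close> by blast
      have "z k (f pos) (q k pos j) = z k' (f pos') (q k' pos' j')" using eq x y lift by simp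
      then have *: "k = k'" "f pos = f pos'" "q k pos j = q k' pos' j'" using zinj qlt x(1) y(1) by metis+
      then have "pos = pos'" using f by (simp add: bij_is_inj inj_eq)
      then have "j = j'" using * x(1) y(1) q[of k pos] by (auto simp: bij_betw_def dest: inj_onD)
      then show ?thesis using x y * \<open>pos = pos'\<close> by simp
    next
      case False
      then have "y \<notin> ZZ" using eq in_ZZ by metis
      then show ?thesis using eq False lift_out by metis
    qed
    moreover have "\<exists>x. y = lift f q x" for y
    proof (cases "y \<in> ZZ")
      case True
      then obtain k pos j where y: "j < k" "y = z k pos j" using zsurj by blast
      obtain pos' where pos': "f pos' = pos" using f by (metis bij_pointE)
      obtain j' where "j' < k" "q k pos' j' = j"
        using bij_betw_imp_surj_on[OF q[of k pos']] y(1) by (metis imageE lessThan_iff)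
      then have "y = lift f q (z k pos' j')" using y pos' lift by simp
      then show ?thesis by blast
    next
      case False
      then show ?thesis using lift_out by metis
    qed
    ultimately show ?thesis by (auto simp: bij_def inj_def surj_def)
  qed
  \<comment> \<open>\<open>flip\<close> exchanges the two copies housed in the same
    \<open>Z (N k i)\<close>.\<close>
  define flip where "flip pos = (if even pos then pos + 1 else pos - 1)" for pos :: int
  have "flip (flip pos) = pos" for pos by (simp add: flip_def)
  then have "bij flip" by (intro o_bij[of flip]) (auto simp: fun_eq_iff)
  have idb: "bij_betw (\<lambda>j. j) {..<k} {..<k}" for k :: nat by (simp add: bij_betw_def)
  define t where "t = lift flip (\<lambda>_ _ j. j)"
  have bt: "bij t" unfolding t_def by (rule bij_lift[OF \<open>bij flip\<close> idb])
  have t: "t (z k pos j) = z k (flip pos) j" if "j < k" for k pos j unfolding t_def by (rule lift[OF that])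
  have "bij (\<lambda>pos :: int. pos + 1)" by (rule o_bij[of "\<lambda>pos. pos - 1"]) (auto simp: fun_eq_iff)
  define v where "v = lift (\<lambda>pos. pos + 1) (\<lambda>_ _ j. j)"
  have bv: "bij v" unfolding v_def by (rule bij_lift[OF \<open>bij (\<lambda>pos. pos + 1)\<close> idb])
  have v: "v (z k pos j) = z k (pos + 1) j" if "j < k" for k pos j unfolding v_def by (rule lift[OF that])
  have t_out: "t x = x" and v_out: "v x = x" if "x \<notin> ZZ" for x
    using that by (simp_all add: t_def v_def lift_out)
  define C where "C k = z k 0 ` {..<k}" for k
  have "disjoint_family C"
    unfolding disjoint_family_on_def
  proof (intro ballI impI)
    fix k k' :: nat assume "k \<noteq> k'"
    then show "C k \<inter> C k' = {}" using zinj by (fastforce simp: C_def)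
  qed
  moreover have "card (C k) = k" "finite (C k)" for k
  proof -
    have "inj_on (z k 0) {..<k}" by (rule inj_onI) (use zinj in auto)
    then show "card (C k) = k" unfolding C_def by (simp add: card_image)
  qed (simp add: C_def)
  moreover have "Sym_fam C \<subseteq> gen_by (G \<union> {u, t, v})"
  proof
    fix \<sigma> assume \<sigma>: "\<sigma> \<in> Sym_fam C"
    then have b\<sigma>: "bij \<sigma>" and \<sigma>C: "\<And>k. \<sigma> ` C k = C k" and \<sigma>_out: "\<And>x. x \<notin> (\<Union>k. C k) \<Longrightarrow> \<sigma> x = x"
      by (auto simp: Sym_fam_def Sym_def)
    define sh where "sh k j = (SOME j'. j' < k \<and> \<sigma> (z k 0 j) = z k 0 j')" for k j
    have sh: "sh k j < k" "\<sigma> (z k 0 j) = z k 0 (sh k j)" if "j < k" for k j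
    proof -
      have "\<sigma> (z k 0 j) \<in> C k" using \<sigma>C[of k] that by (auto simp: C_def)
      then have "\<exists>j'. j' < k \<and> \<sigma> (z k 0 j) = z k 0 j'" by (auto simp: C_def)
      from someI_ex[OF this] show "sh k j < k" "\<sigma> (z k 0 j) = z k 0 (sh k j)" by (simp_all add: sh_def)
    qed
    have sh_bij: "bij_betw (sh k) {..<k} {..<k}" for k
    proof -
      have "inj_on (sh k) {..<k}"
      proof (rule inj_onI)
        fix i j assume ij: "i \<in> {..<k}" "j \<in> {..<k}" "sh k i = sh k j"
        then have "\<sigma> (z k 0 i) = \<sigma> (z k 0 j)" using sh(2)[of i k] sh(2)[of j k] by simp
        then have "z k 0 i = z k 0 j" using b\<sigma> by (simp add: bij_is_inj inj_eq)
        then show "i = j" using zinj[of i k j k 0 0] ij by simp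
      qed
      moreover have "sh k ` {..<k} \<subseteq> {..<k}" using sh(1) by auto
      ultimately show ?thesis by (simp add: bij_betw_def endo_inj_surj)
    qed
    \<comment> \<open>\<open>\<sigma>\<close> is copied to the even positions of a half-line only;
      its end at 0 is where a single copy will survive.\<close>
    define q where "q k pos = (if pos \<ge> 0 \<and> even pos then sh k else (\<lambda>j. j))" for k and pos :: int
    have q_bij: "bij_betw (q k pos) {..<k} {..<k}" for k pos
      using sh_bij idb by (simp add: q_def)
    define \<pi> where "\<pi> = lift id q"
    have \<pi>: "\<pi> (z k pos j) = z k pos (q k pos j)" if "j < k" for k pos j
      unfolding \<pi>_def using lift[OF that, of id q pos] by simp
    have b\<pi>: "bij \<pi>" unfolding \<pi>_def by (rule bij_lift[OF bij_id q_bij])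
    have qlt: "q k pos j < k" if "j < k" for k pos j using bij_betwE[OF q_bij[of k pos]] that by auto
    have \<pi>Z: "\<pi> x \<in> Z n" if x: "x \<in> Z n" for x n
    proof (cases "x \<in> ZZ")
      case True
      then obtain k pos j where kpj: "j < k" "x = z k pos j" using zsurj by blast
      then have "n = N k (pos div 2)" using zZ[OF kpj(1), of pos] x Z(2) unfolding disjoint_family_on_def by auto
      then show ?thesis using \<pi>[OF kpj(1)] zZ[OF qlt[OF kpj(1)]] kpj(2) by simp
    next
      case False
      then show ?thesis using x by (simp add: \<pi>_def lift_out)
    qed
    have "bij_betw \<pi> (Z n) (Z n)" for n
    proof -
      have "inj_on \<pi> (Z n)" using b\<pi> by (auto simp: bij_def inj_on_def)
      moreover have "\<pi> ` Z n = Z n" using \<pi>Z Z(1) calculation by (intro endo_inj_surj) auto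
      ultimately show ?thesis by (simp add: bij_betw_def)
    qed
    then obtain g where g: "g \<in> G" "\<forall>n. \<forall>x\<in>Z n. u (g x) = g (\<pi> x)" using real by blast
    have bg: "bij g" using is_subgroupD(1)[OF G(1) g(1)] .
    \<comment> \<open>On \<open>ZZ\<close> this is \<open>\<pi>\<close>; outside, only the
      invariance of the complement is known.\<close>
    define w where "w = inv g \<circ> (u \<circ> g)"
    have bw: "bij w" unfolding w_def using bg bu by (intro bij_comp bij_imp_bij_inv)
    have w: "w (z k pos j) = z k pos (q k pos j)" if "j < k" for k pos j
      using g(2) zZ[OF that, of pos] \<pi>[OF that] bg by (simp add: w_def bij_is_inj)
    have inv_w: "inv w (z k pos (q k pos j)) = z k pos j" if "j < k" for k pos j
      using w[OF that] bw by (metis bij_inv_eq_iff)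
    have w_out: "inv w x \<notin> ZZ" if "x \<notin> ZZ" for x
    proof
      assume "inv w x \<in> ZZ"
      then obtain k pos j where kpj: "j < k" "inv w x = z k pos j" using zsurj by blast
      then have "x = z k pos (q k pos j)" using w[OF kpj(1)] bw by (metis bij_inv_eq_iff)
      then show False using that zZZ[OF qlt[OF kpj(1)]] by simp
    qed
    \<comment> \<open>\<open>t\<close> is an involution, so this is a commutator. As
      \<open>t\<close> is trivial off \<open>ZZ\<close>, the unknown part of \<open>w\<close>
      cancels there.\<close>
    define \<alpha> where "\<alpha> = w \<circ> (t \<circ> (inv w \<circ> t))"
    have \<alpha>_even: "\<alpha> (z k pos j) = z k pos (sh k j)" if "j < k" "pos \<ge> 0" "even pos" for k pos j
      using that t[OF that(1)] inv_w[OF that(1), of "pos + 1"] w[OF that(1)] by (simp add: \<alpha>_def flip_def q_def)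
    have \<alpha>_odd: "\<alpha> (z k pos (sh k j)) = z k pos j" if "j < k" "pos \<ge> 0" "odd pos" for k pos j
    proof -
      have "pos - 1 \<ge> 0" "even (pos - 1)" using that by (auto elim!: oddE)
      then show ?thesis
        using that t[OF sh(1)[OF that(1)]] t[OF that(1)] inv_w[OF that(1), of "pos - 1"] w[OF that(1)]
        by (simp add: \<alpha>_def flip_def q_def)
    qed
    have \<alpha>_neg: "\<alpha> (z k pos j) = z k pos j" if "j < k" "pos < 0" for k pos j
    proof -
      have "flip pos < 0" "flip (flip pos) = pos" using that(2) by (auto simp: flip_def)
      then show ?thesis
        using that(2) t[OF that(1)] inv_w[OF that(1), of "flip pos"] w[OF that(1)] by (simp add: \<alpha>_def q_def)
    qed
    have \<alpha>_out: "\<alpha> x = x" if "x \<notin> ZZ" for x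
      using that w_out[OF that] t_out bw by (simp add: \<alpha>_def bij_is_surj surj_f_inv_f)
    \<comment> \<open>Moving by one position turns the pattern of \<open>\<alpha>\<close> into its
      inverse from position 1 on, so in \<open>\<alpha> \<circ> \<beta>\<close> only position 0
      survives.\<close>
    define \<beta> where "\<beta> = v \<circ> (\<alpha> \<circ> inv v)"
    have inv_v: "inv v (z k pos j) = z k (pos - 1) j" if "j < k" for k pos j
      using v[OF that, of "pos - 1"] bv by (metis bij_inv_eq_iff diff_add_cancel)
    have inv_v_out: "inv v x = x" if "x \<notin> ZZ" for x
      using v_out[OF that] bv by (metis bij_inv_eq_iff)
    have \<beta>_odd: "\<beta> (z k pos j) = z k pos (sh k j)" if "j < k" "pos > 0" "odd pos" for k pos j
      using that inv_v[OF that(1)] \<alpha>_even[OF that(1), of "pos - 1"] v[OF sh(1)[OF that(1)]] by (simp add: \<beta>_def)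
    have \<beta>_even: "\<beta> (z k pos (sh k j)) = z k pos j" if "j < k" "pos > 0" "even pos" for k pos j
      using that inv_v[OF sh(1)[OF that(1)]] \<alpha>_odd[OF that(1), of "pos - 1"] v[OF that(1)] by (simp add: \<beta>_def)
    have \<beta>_neg: "\<beta> (z k pos j) = z k pos j" if "j < k" "pos \<le> 0" for k pos j
      using that inv_v[OF that(1)] \<alpha>_neg[OF that(1), of "pos - 1"] v[OF that(1)] by (simp add: \<beta>_def)
    have \<beta>_out: "\<beta> x = x" if "x \<notin> ZZ" for x
      using that inv_v_out \<alpha>_out v_out by (simp add: \<beta>_def)
    have \<sigma>_ne0: "\<sigma> (z k pos j) = z k pos j" if "j < k" "pos \<noteq> 0" for k pos j
    proof (rule \<sigma>_out)
      show "z k pos j \<notin> (\<Union>k. C k)" using zinj[OF that(1)] that(2) by (auto simp: C_def)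
    qed
    have "\<sigma> x = \<alpha> (\<beta> x)" for x
    proof (cases "x \<in> ZZ")
      case True
      then obtain k pos j where x: "j < k" "x = z k pos j" using zsurj by blast
      consider "pos < 0" | "pos = 0" | "pos > 0" "odd pos" | "pos > 0" "even pos" by linarith
      then show ?thesis
      proof cases
        case 1
        then show ?thesis using x \<sigma>_ne0 \<beta>_neg \<alpha>_neg by simp
      next
        case 2
        then show ?thesis using x sh(2) \<beta>_neg \<alpha>_even by simp
      next
        case 3
        then show ?thesis using x \<sigma>_ne0 \<beta>_odd \<alpha>_odd by simp
      next
        case 4
        obtain i where "i < k" "j = sh k i"
          using bij_betw_imp_surj_on[OF sh_bij[of k]] x(1) by (metis imageE lessThan_iff)
        then show ?thesis using 4 x \<sigma>_ne0 \<beta>_even \<alpha>_even by simp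
      qed
    next
      case False
      have "x \<notin> (\<Union>k. C k)" using False zZZ by (auto simp: C_def)
      then show ?thesis using False \<sigma>_out \<alpha>_out \<beta>_out by simp
    qed
    then have eq: "\<sigma> = \<alpha> \<circ> \<beta>" by auto
    let ?H = "gen_by (G \<union> {u, t, v})"
    have base: "g \<in> ?H" "u \<in> ?H" "t \<in> ?H" "v \<in> ?H" using g(1) by (auto intro: gen_by.gen_base)
    have "w \<in> ?H" unfolding w_def by (intro gen_by.gen_comp gen_by.gen_inv base)
    then have "\<alpha> \<in> ?H" unfolding \<alpha>_def by (intro gen_by.gen_comp gen_by.gen_inv base)
    then show "\<sigma> \<in> ?H" unfolding eq \<beta>_def by (intro gen_by.gen_comp gen_by.gen_inv base)
  qed
  then have "preceq (Sym_fam C) G"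
    unfolding preceq_def using bu bt bv by (intro exI[of _ "{u, t, v}"]) (auto simp: Sym_def)
  ultimately show ?thesis by blast
qed

section \<open>The full symmetric group and the conclusion\<close>

text \<open>Cutting an enumeration at the squares gives blocks of sizes 1, 3, 5 and so on. A member
  is needed because equivalence with all \<open>Sym_part A\<close> would otherwise be
  vacuous.\<close>

lemma unbounded_partitions_nonempty:
  assumes inf: "infinite (UNIV :: 'a::countable set)"
  shows "(unbounded_partitions :: 'a set set set) \<noteq> {}"
proof -
  define e where "e = from_nat_into (UNIV :: 'a set)"
  have e: "bij e" unfolding e_def using bij_betw_from_nat_into[OF countableI_type inf] .
  define H where "H j = e ` {..<j * j}" for j
  have card: "card (H j) = j * j" and fin: "finite (H j)" for j
    unfolding H_def using e by (simp_all add: card_image bij_is_inj inj_on_subset[of e UNIV])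
  have mono: "H j \<subseteq> H (Suc j)" for j by (auto simp: H_def)
  have "finite_block_partition (layers H)"
  proof (rule finite_block_partition_layers)
    show "\<exists>j. x \<in> H j" for x
    proof -
      obtain n where "x = e n" using e by (metis bij_pointE)
      then have "x \<in> H (Suc n)" by (auto simp: H_def)
      then show ?thesis by blast
    qed
  qed (use fin mono in \<open>simp_all add: H_def\<close>)
  moreover have "\<not> (\<forall>B\<in>layers H. card B \<le> n)" for n
  proof -
    have c: "card (H (Suc n) - H n) = 2 * n + 1"
      using card_Diff_subset[OF fin mono[of n]] card[of "Suc n"] card[of n] by simp
    then have "H (Suc n) - H n \<noteq> {}" by (metis add_is_0 card.empty one_neq_zero)
    then have "H (Suc n) - H n \<in> layers H" unfolding layers_def by simp
    then show ?thesis using c by (metis le_add2 mult_2 not_less_eq_eq Suc_eq_plus1)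
  qed
  ultimately show ?thesis by (auto simp: unbounded_partitions_def)
qed

text \<open>\<open>Sym\<close> is closed, and the stabilizer of a finite set is still transitive on
  the infinite complement, so the necessary condition of finite orbits fails.\<close>

lemma Sym_not_preceq_Sym_part:
  assumes inf: "infinite (UNIV :: 'a::countable set)" and A: "finite_block_partition (A :: 'a set set)"
  shows "\<not> preceq Sym (Sym_part A)"
proof
  assume le: "preceq Sym (Sym_part A)"
  have "closed_in_Sym Sym" by (simp add: closed_in_Sym_def)
  then obtain \<Gamma> :: "'a set" where \<Gamma>: "finite \<Gamma>" "\<And>x. finite (orbit_of (pstab Sym \<Gamma>) x)"
    using preceq_Sym_part_imp_finite_orbits[OF is_subgroup_Sym _ A le] by blast
  obtain x where x: "x \<notin> \<Gamma>" using \<Gamma>(1) inf by (metis UNIV_eq_I)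
  have "- \<Gamma> \<subseteq> orbit_of (pstab Sym \<Gamma>) x"
  proof
    fix y assume "y \<in> - \<Gamma>"
    then have "Transposition.transpose x y \<in> pstab Sym \<Gamma>"
      using x by (auto simp: pstab_def Sym_def Transposition.transpose_def)
    then show "y \<in> orbit_of (pstab Sym \<Gamma>) x"
      unfolding orbit_of_def by (intro CollectI exI[of _ "Transposition.transpose x y"]) simp
  qed
  then have "finite (- \<Gamma>)" using \<Gamma>(2) finite_subset by blast
  then show False using \<Gamma>(1) inf by (simp add: finite_compl)
qed

theorem theorem6p2:
  assumes "infinite (UNIV :: ('a::countable) set)"
  shows "(\<forall>A\<in>(unbounded_partitions :: 'a set set set). \<forall>B\<in>unbounded_partitions.
            equiv_sg (Sym_part A) (Sym_part B))
       \<and> (\<forall>G :: ('a \<Rightarrow> 'a) set. is_subgroup G \<and> closed_in_Sym G \<longrightarrow>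
            ((\<forall>A\<in>unbounded_partitions. equiv_sg G (Sym_part A)) \<longleftrightarrow>
              ((\<exists>\<Gamma>. finite \<Gamma> \<and> (\<forall>x. finite (orbit_of (pstab G \<Gamma>) x))) \<and>
               \<not> (\<exists>\<Gamma>. finite \<Gamma> \<and> (\<exists>n::nat. \<forall>x. finite (orbit_of (pstab G \<Gamma>) x)
                                                 \<and> card (orbit_of (pstab G \<Gamma>) x) \<le> n)))))
       \<and> (\<forall>A\<in>(unbounded_partitions :: 'a set set set). prec (Sym_part A) Sym)"
proof (intro conjI ballI allI impI)
  have fbp: "finite_block_partition A" if "A \<in> unbounded_partitions" for A :: "'a set set"
    using that by (simp add: unbounded_partitions_def)
  show "equiv_sg (Sym_part A) (Sym_part B)"
    if "A \<in> unbounded_partitions" "B \<in> unbounded_partitions" for A B :: "'a set set"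
    unfolding equiv_sg_def using Sym_part_preceq_Sym_part[OF assms] fbp that by blast
  show "prec (Sym_part A) Sym" if "A \<in> unbounded_partitions" for A :: "'a set set"
    unfolding prec_def using Sym_not_preceq_Sym_part[OF assms fbp[OF that]]
    by (auto simp: Sym_part_def intro: preceq_subset)
  fix G :: "('a \<Rightarrow> 'a) set" assume "is_subgroup G \<and> closed_in_Sym G"
  then have G: "is_subgroup G" "closed_in_Sym G" by auto
  let ?fin = "\<exists>\<Gamma>. finite \<Gamma> \<and> (\<forall>x. finite (orbit_of (pstab G \<Gamma>) x))"
  let ?bdd = "\<exists>\<Gamma>. finite \<Gamma> \<and> (\<exists>n::nat. \<forall>x. finite (orbit_of (pstab G \<Gamma>) x)
    \<and> card (orbit_of (pstab G \<Gamma>) x) \<le> n)"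
  show "(\<forall>A\<in>unbounded_partitions. equiv_sg G (Sym_part A)) \<longleftrightarrow> ?fin \<and> \<not> ?bdd"
  proof
    assume eq: "\<forall>A\<in>unbounded_partitions. equiv_sg G (Sym_part A)"
    obtain A :: "'a set set" where A: "A \<in> unbounded_partitions"
      using unbounded_partitions_nonempty[OF assms] by blast
    then have le: "preceq G (Sym_part A)" "preceq (Sym_part A) G" using eq by (auto simp: equiv_sg_def)
    have ?fin by (rule preceq_Sym_part_imp_finite_orbits[OF G fbp[OF A] le(1)])
    moreover have "\<not> ?bdd"
    proof
      assume ?bdd
      then obtain \<Gamma> n where \<Gamma>: "finite \<Gamma>"
        "\<forall>x. finite (orbit_of (pstab G \<Gamma>) x) \<and> card (orbit_of (pstab G \<Gamma>) x) \<le> n" by blast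
      show False using bounded_orbits_not_Sym_part_preceq[OF G(1) \<Gamma>(1) \<Gamma>(2)[rule_format] A] le(2) by blast
    qed
    ultimately show "?fin \<and> \<not> ?bdd" ..
  next
    assume fb: "?fin \<and> \<not> ?bdd"
    then obtain \<Gamma> where \<Gamma>: "finite \<Gamma>" "\<And>x. finite (orbit_of (pstab G \<Gamma>) x)" by blast
    \<comment> \<open>\<open>pstab G \<Gamma>\<close> is closed and has only finite orbits, so the
      realization argument is applied to it. A common bound after fixing \<open>\<Delta>\<close> as
      well would be one for \<open>G\<close> with the finite set
      \<open>\<Gamma> \<union> \<Delta>\<close>.\<close>
    have unb: "\<exists>x. N < card (orbit_of (pstab (pstab G \<Gamma>) \<Delta>) x)" if \<Delta>: "finite \<Delta>" for \<Delta> N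
    proof (rule ccontr)
      assume "\<not> ?thesis"
      then have "card (orbit_of (pstab G (\<Gamma> \<union> \<Delta>)) x) \<le> N" for x by (simp add: pstab_pstab not_less)
      moreover have "finite (orbit_of (pstab G (\<Gamma> \<union> \<Delta>)) x)" for x
        by (rule finite_subset[OF _ \<Gamma>(2)[of x]]) (auto simp: orbit_of_def pstab_def)
      moreover have "finite (\<Gamma> \<union> \<Delta>)" using \<Gamma>(1) \<Delta> by simp
      ultimately show False using fb by blast
    qed
    obtain C :: "nat \<Rightarrow> 'a set" where C: "disjoint_family C" "\<forall>n. finite (C n) \<and> card (C n) = n"
      "preceq (Sym_fam C) (pstab G \<Gamma>)"
      using Sym_fam_preceq_unbounded_orbits[OF is_subgroup_pstab[OF G(1)] closed_in_Sym_pstab[OF G(2)] \<Gamma>(2)] unb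
      by blast
    have sub: "preceq (pstab G \<Gamma>) G" by (rule preceq_subset) (auto simp: pstab_def)
    show "\<forall>A\<in>unbounded_partitions. equiv_sg G (Sym_part A)"
    proof
      fix A :: "'a set set" assume A: "A \<in> unbounded_partitions"
      have "preceq (Sym_part A) (Sym_fam C)"
        by (rule Sym_part_preceq_Sym_fam[OF assms C(1) _ _ fbp[OF A]]) (simp_all add: C(2))
      from preceq_trans[OF preceq_trans[OF this C(3)] sub] have "preceq (Sym_part A) G" .
      moreover have "preceq G (Sym_part A)"
        by (rule finite_orbits_imp_preceq_Sym_part[OF assms G(1) \<Gamma> A])
      ultimately show "equiv_sg G (Sym_part A)" by (simp add: equiv_sg_def)
    qed
  qed
qed

end
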